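(* Let $\Omega\subset\mathbb{R}^2$ be a bounded, smooth, doubly connected domain such that the bounded component of $\mathbb{R}^2\setminus\Omega$ is not a point. Then there exists a simple, closed and smooth curve $\gamma\subset\Omega$ such that its harmonic measure $H_\gamma$ in $\Omega$ satisfies $$\partial_nH^+_\gamma+\partial_nH^-_\gamma=0\quad\text{on }\gamma.$$
   Context: For a smooth simple closed curve $\gamma\subset\Omega$, the harmonic measure $H_\gamma$ of $\gamma$ in $\Omega$ is the function, continuous on $\overline\Omega$ and $C^2$ in $\Omega\setminus\gamma$, such that $\Delta H_\gamma=0$ in $\Omega\setminus\gamma$, $H_\gamma=0$ on $\partial\Omega$, $H_\gamma=1$ on $\gamma$. The curve $\gamma$ divides $\Omega$ into two disjoint components $\Omega^+$ and $\Omega^-$, and $H_\gamma^\pm=H_\gamma|_{\Omega^\pm}$. The vector $n$ is the unit normal on $\gamma$ which is exterior to $\Omega^-$ and interior to $\Omega^+$; $\partial_nH^\pm_\gamma$ on $\gamma$ are the derivatives in direction $n$ taken from within $\Omega^\pm$. *)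

theory Defs
  imports "HOL-Analysis.Analysis"
begin

text \<open>
  Throughout, the plane \<open>\<real>\<^sup>2\<close> is the Euclidean space \<^typ>\<open>complex\<close>, as in
  \<^theory>\<open>HOL-Analysis.Jordan_Curve\<close>. Only its real inner product structure is used.
\<close>

text \<open>
  Meant for open \<open>S\<close>. Asking all directional derivatives to be \<open>C\<^sup>k\<close> gives the usual
  class \<open>C\<^sup>k\<^sup>+\<^sup>1\<close> in finite dimension.
\<close>

primrec Ck_on ::
  "nat \<Rightarrow> ('a::euclidean_space \<Rightarrow> 'b::real_normed_vector) \<Rightarrow> 'a set \<Rightarrow> bool" where
  "Ck_on 0 f S \<longleftrightarrow> continuous_on S f"
| "Ck_on (Suc k) f S \<longleftrightarrow>
     (\<forall>x\<in>S. f differentiable (at x)) \<and> (\<forall>v. Ck_on k (\<lambda>x. frechet_derivative f (at x) v) S)"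

definition smooth_on ::
  "('a::euclidean_space \<Rightarrow> 'b::real_normed_vector) \<Rightarrow> 'a set \<Rightarrow> bool" where
  "smooth_on f S \<longleftrightarrow> (\<forall>k. Ck_on k f S)"

definition laplacian :: "('a::euclidean_space \<Rightarrow> real) \<Rightarrow> 'a \<Rightarrow> real" where
  "laplacian f x =
     (\<Sum>b\<in>Basis. frechet_derivative (\<lambda>y. frechet_derivative f (at y) b) (at x) b)"

text \<open>
  Near each boundary point the set is the sublevel set of a smooth function without critical
  points; equivalently it lies locally on one side of a smooth graph.
\<close>

definition smooth_boundary :: "complex set \<Rightarrow> bool" where
  "smooth_boundary \<Omega> \<longleftrightarrow>
     (\<forall>p\<in>frontier \<Omega>. \<exists>U. \<exists>\<phi>::complex \<Rightarrow> real.
        open U \<and> p \<in> U \<and> smooth_on \<phi> U \<and>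
        (\<forall>x\<in>U. \<exists>v. frechet_derivative \<phi> (at x) v \<noteq> 0) \<and>
        \<Omega> \<inter> U = {x\<in>U. \<phi> x < 0})"

text \<open>
  Doubly connected means that the complement in the Riemann sphere has two components. For
  bounded \<open>\<Omega>\<close>, adding the point at infinity only enlarges the unique unbounded component of
  \<open>- \<Omega>\<close>, so the components may be counted in the plane. Exactly one of them is bounded.
\<close>

definition bounded_doubly_connected_domain :: "complex set \<Rightarrow> bool" where
  "bounded_doubly_connected_domain \<Omega> \<longleftrightarrow>
     open \<Omega> \<and> connected \<Omega> \<and> bounded \<Omega> \<and> card (components (- \<Omega>)) = 2"

text \<open>
  A regular parametrization on \<open>[0, 1]\<close>, extended periodically so that the curve is also smooth
  where it closes up.
\<close>

definition smooth_simple_closed_curve :: "(real \<Rightarrow> complex) \<Rightarrow> bool" where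
  "smooth_simple_closed_curve g \<longleftrightarrow>
     simple_path g \<and> pathfinish g = pathstart g \<and>
     (\<forall>t. g (t + 1) = g t) \<and> smooth_on g UNIV \<and>
     (\<forall>t. vector_derivative g (at t) \<noteq> 0)"

text \<open>\<open>\<Gamma>\<close> is the point set of a smooth simple closed curve in \<open>\<Omega>\<close>.
  These conditions determine \<open>H\<close> on \<^term>\<open>closure \<Omega>\<close>; its values elsewhere play no role.\<close>

definition is_harmonic_measure ::
  "complex set \<Rightarrow> complex set \<Rightarrow> (complex \<Rightarrow> real) \<Rightarrow> bool" where
  "is_harmonic_measure \<Omega> \<Gamma> H \<longleftrightarrow>
     continuous_on (closure \<Omega>) H \<and> Ck_on 2 H (\<Omega> - \<Gamma>) \<and>
     (\<forall>x\<in>\<Omega> - \<Gamma>. laplacian H x = 0) \<and>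
     (\<forall>x\<in>frontier \<Omega>. H x = 0) \<and> (\<forall>x\<in>\<Gamma>. H x = 1)"

text \<open>\<open>n\<close> is the unit normal on the curve \<open>g\<close>, exterior to \<open>\<Omega>m\<close> and interior to \<open>\<Omega>p\<close>.\<close>

definition is_unit_normal ::
  "(real \<Rightarrow> complex) \<Rightarrow> complex set \<Rightarrow> complex set \<Rightarrow> (complex \<Rightarrow> complex) \<Rightarrow> bool" where
  "is_unit_normal g \<Omega>m \<Omega>p n \<longleftrightarrow>
     (\<forall>t. norm (n (g t)) = 1 \<and> n (g t) \<bullet> vector_derivative g (at t) = 0 \<and>
          (\<forall>\<^sub>F s in at_right 0. g t + s *\<^sub>R n (g t) \<in> \<Omega>p \<and> g t - s *\<^sub>R n (g t) \<in> \<Omega>m))"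

text \<open>
  The derivative of \<open>f\<close> at \<open>p\<close> in direction \<open>v\<close> taken from within \<open>A\<close>: the limit of
  \<open>(f (p + t v) - f p) / t\<close> as \<open>t \<rightarrow> 0\<close> with \<open>p + t v \<in> A\<close>. If \<open>v\<close> points out of \<open>A\<close>,
  then \<open>t\<close> is negative.
\<close>

definition has_derivative_from_within ::
  "(complex \<Rightarrow> real) \<Rightarrow> complex \<Rightarrow> complex \<Rightarrow> complex set \<Rightarrow> real \<Rightarrow> bool" where
  "has_derivative_from_within f p v A d \<longleftrightarrow>
     ((\<lambda>t. f (p + t *\<^sub>R v)) has_real_derivative d) (at 0 within {t. p + t *\<^sub>R v \<in> A})"

end

theory Submission
  imports Defs "HOL-Complex_Analysis.Complex_Analysis"
begin

text \<open>
  Such a domain is conformally an annulus, and the middle circle of the annulus is the required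
  curve. Let \<open>p\<close> lie in the bounded component of the complement and let \<open>S\<close> be a component of
  \<open>{z. p + exp z \<in> \<Omega>}\<close>. It is simply connected, and the translations by multiples of \<open>2\<pi>i\<close> that
  preserve it form an infinite cyclic group. Its generator becomes, under a Riemann map, an
  automorphism of the disc without fixed points. If the automorphism is parabolic, \<open>\<Omega>\<close> is
  conformally a punctured disc, and by Riemann's theorem on removable singularities its complement
  has an isolated point, which is excluded.
  Otherwise it is hyperbolic, and \<open>\<Omega> = G ` {z. \<bar>Re z\<bar> < a}\<close> where \<open>G\<close> is holomorphic with period \<open>i\<close>
  and injective modulo this period. Then \<open>\<gamma> t = G (i t)\<close>, and the harmonic measure is
  \<open>1 - \<bar>Re z\<bar> / a\<close> at the point \<open>G z\<close>, which is symmetric about the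
  curve. It vanishes on the boundary because \<open>G\<close> modulo its period is proper.
\<close>

section \<open>Smooth functions and harmonicity\<close>

text \<open>Derivatives at a point depend only on nearby values, so on an open set equality of
  functions passes to all their derivatives.\<close>

lemma Ck_on_cong:
  assumes "open S" and "Ck_on k f S" and "\<And>x. x \<in> S \<Longrightarrow> f x = g x"
  shows "Ck_on k g S"
  using assms(2,3)
proof (induction k arbitrary: f g)
  case 0
  then show ?case
    using continuous_on_cong[of S S f g] by simp
next
  case (Suc k)
  have diff: "f differentiable (at x)" if "x \<in> S" for x
    using Suc.prems that by simp
  have frech: "frechet_derivative f (at x) = frechet_derivative g (at x)" if "x \<in> S" for x
    by (rule frechet_derivative_transform_within_open[OF diff \<open>open S\<close>])
      (use that Suc.prems in auto)
  have "g differentiable (at x)" if "x \<in> S" for x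
    using diff[OF that] Suc.prems(2) \<open>open S\<close> that
    unfolding differentiable_def by (metis has_derivative_transform_within_open)
  moreover have "Ck_on k (\<lambda>x. frechet_derivative g (at x) v) S" for v
    by (rule Suc.IH[of "\<lambda>x. frechet_derivative f (at x) v"]) (use Suc.prems frech in auto)
  ultimately show ?case
    by simp
qed

lemma Ck_on_local:
  assumes "\<And>x. x \<in> S \<Longrightarrow> \<exists>U. open U \<and> x \<in> U \<and> Ck_on k f U"
  shows "Ck_on k f S"
  using assms
proof (induction k arbitrary: f)
  case 0
  have "continuous (at x within S) f" if x: "x \<in> S" for x
  proof -
    obtain U where "open U" "x \<in> U" "continuous_on U f"
      using 0[OF x] by auto
    then show ?thesis
      by (metis continuous_at_imp_continuous_within continuous_on_eq_continuous_at)
  qed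
  then show ?case
    by (simp add: continuous_on_eq_continuous_within)
next
  case (Suc k)
  have "f differentiable (at x)" if "x \<in> S" for x
    using Suc.prems[OF that] by auto
  moreover have "Ck_on k (\<lambda>x. frechet_derivative f (at x) v) S" for v
    by (rule Suc.IH) (use Suc.prems in fastforce)
  ultimately show ?case
    by simp
qed

lemma has_derivative_Re_holomorphic:
  assumes "f holomorphic_on S" "open S" "x \<in> S"
  shows "((\<lambda>x. Re (f x)) has_derivative (\<lambda>v. Re (deriv f x * v))) (at x)"
proof -
  have "(f has_derivative (*) (deriv f x)) (at x)"
    using holomorphic_derivI[OF assms] by (simp add: has_field_derivative_def)
  then show ?thesis
    by (rule has_derivative_Re)
qed

text \<open>The derivative of \<open>Re (f x)\<close> in direction \<open>v\<close> is
  \<open>Re (deriv f x * v)\<close>, again the real part of a holomorphic function, so the induction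
  stays in this class.\<close>

lemma Ck_on_Re_holomorphic:
  assumes "f holomorphic_on S" "open S"
  shows "Ck_on k (\<lambda>x. Re (f x)) S"
  using assms(1)
proof (induction k arbitrary: f)
  case 0
  then show ?case
    by (simp add: holomorphic_on_imp_continuous_on continuous_on_Re)
next
  case (Suc k)
  note der = has_derivative_Re_holomorphic[OF Suc.prems \<open>open S\<close>]
  have "Ck_on k (\<lambda>x. frechet_derivative (\<lambda>x. Re (f x)) (at x) v) S" for v
  proof (rule Ck_on_cong[OF \<open>open S\<close>])
    show "Ck_on k (\<lambda>x. Re (deriv f x * v)) S"
      by (intro Suc.IH holomorphic_intros holomorphic_deriv Suc.prems \<open>open S\<close>)
    show "Re (deriv f x * v) = frechet_derivative (\<lambda>x. Re (f x)) (at x) v" if "x \<in> S" for x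
      using frechet_derivative_at[OF der[OF that]] by metis
  qed
  then show ?case
    using der differentiable_def by fastforce
qed


text \<open>The second derivative in direction \<open>b\<close> is the real part of
  \<open>deriv (deriv f) x * b * b\<close>, and the basis vectors 1 and \<open>\<i>\<close> have
  squares with sum zero.\<close>

lemma laplacian_eq_Re_holomorphic:
  fixes g :: "complex \<Rightarrow> real"
  assumes f: "f holomorphic_on S" and "open S" and eq: "\<And>x. x \<in> S \<Longrightarrow> g x = Re (f x)" and "x \<in> S"
  shows "laplacian g x = 0"
proof -
  note der = has_derivative_Re_holomorphic[OF f \<open>open S\<close>]
  have frech: "frechet_derivative g (at y) b = Re (deriv f y * b)" if "y \<in> S" for y b
  proof -
    have "(g has_derivative (\<lambda>v. Re (deriv f y * v))) (at y)"
      by (rule has_derivative_transform_within_open[OF der[OF that] \<open>open S\<close> that]) (simp add: eq)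
    then show ?thesis
      using frechet_derivative_at by metis
  qed
  have "frechet_derivative (\<lambda>y. frechet_derivative g (at y) b) (at x) b = Re (deriv (deriv f) x * b * b)" for b
  proof -
    have "(\<lambda>y. deriv f y * b) holomorphic_on S"
      by (intro holomorphic_intros holomorphic_deriv f \<open>open S\<close>)
    note d = has_derivative_Re_holomorphic[OF this \<open>open S\<close> \<open>x \<in> S\<close>]
    have "((\<lambda>y. frechet_derivative g (at y) b) has_derivative (\<lambda>v. Re (deriv (\<lambda>y. deriv f y * b) x * v))) (at x)"
      by (rule has_derivative_transform_within_open[OF d \<open>open S\<close> \<open>x \<in> S\<close>]) (simp add: frech)
    moreover have "deriv (\<lambda>y. deriv f y * b) x = deriv (deriv f) x * b"
      by (intro DERIV_imp_deriv DERIV_cmult_right holomorphic_derivI[OF holomorphic_deriv[OF f \<open>open S\<close>]] \<open>open S\<close> \<open>x \<in> S\<close>)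
    ultimately show ?thesis
      using frechet_derivative_at by metis
  qed
  then show ?thesis
    by (simp add: laplacian_def Basis_complex_def)
qed

text \<open>Differentiation in direction \<open>v\<close> replaces \<open>f\<close> by the
  holomorphic function \<open>v * (deriv f z * \<i>)\<close> restricted to the same line, so the
  induction runs over all holomorphic \<open>f\<close>.\<close>

lemma smooth_on_comp_imaginary_line:
  assumes "f holomorphic_on V" "open V" "\<And>t::real. \<i> * of_real t \<in> V"
  shows "smooth_on (\<lambda>t::real. f (\<i> * of_real t)) UNIV"
proof -
  have "Ck_on k (\<lambda>t::real. f (\<i> * of_real t)) UNIV" for k
    using assms(1)
  proof (induction k arbitrary: f)
    case 0
    have "continuous_on UNIV (\<lambda>t::real. f (\<i> * of_real t))"
      by (rule continuous_on_compose2[OF holomorphic_on_imp_continuous_on[OF 0]])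
        (use assms in \<open>auto intro!: continuous_intros\<close>)
    then show ?case
      by simp
  next
    case (Suc k)
    have der: "((\<lambda>t::real. f (\<i> * of_real t)) has_derivative (\<lambda>s. of_real s * (deriv f (\<i> * of_real t) * \<i>))) (at t)"
      for t
    proof -
      have "(f has_field_derivative deriv f (\<i> * of_real t)) (at (\<i> * of_real t))"
        using Suc.prems assms holomorphic_derivI by blast
      then have "((\<lambda>z. f (\<i> * z)) has_field_derivative deriv f (\<i> * of_real t) * \<i>) (at (of_real t))"
        by (auto intro!: derivative_eq_intros DERIV_chain2[where f=f])
      then have "((\<lambda>t. f (\<i> * of_real t)) has_vector_derivative deriv f (\<i> * of_real t) * \<i>) (at t)"
        by (rule has_vector_derivative_real_field)
      then show ?thesis
        by (simp add: has_vector_derivative_def scaleR_conv_of_real)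
    qed
    have "(\<lambda>t. frechet_derivative (\<lambda>t::real. f (\<i> * of_real t)) (at t) v)
        = (\<lambda>t. (\<lambda>z. of_real v * (deriv f z * \<i>)) (\<i> * of_real t))" for v
      using frechet_derivative_at[OF der] by metis
    moreover have "Ck_on k (\<lambda>t::real. (\<lambda>z. of_real v * (deriv f z * \<i>)) (\<i> * of_real t)) UNIV" for v
      by (rule Suc.IH) (intro holomorphic_intros holomorphic_deriv Suc.prems assms)
    ultimately show ?case
      using der by (auto simp: differentiable_def)
  qed
  then show ?thesis
    by (simp add: smooth_on_def)
qed

text \<open>A connected set between \<open>A\<close> and the union cannot meet \<open>B\<close>,
  since two disjoint open sets would split it.\<close>

lemma components_Un_open:
  assumes "open A" "open B" "connected A" "connected B" "A \<noteq> {}" "B \<noteq> {}" "A \<inter> B = {}"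
  shows "components (A \<union> B) = {A, B}"
proof -
  have *: "C \<in> components (C \<union> D)"
    if "open C" "open D" "connected C" "C \<noteq> {}" "C \<inter> D = {}" for C D :: "'a set"
  proof -
    have "T = C" if "C \<subseteq> T" "T \<subseteq> C \<union> D" "connected T" for T
      using connectedD[OF \<open>connected T\<close> \<open>open C\<close> \<open>open D\<close>] \<open>C \<inter> D = {}\<close> \<open>C \<noteq> {}\<close> that by blast
    then show ?thesis
      using that by (auto simp: in_components_maximal)
  qed
  have "A \<in> components (A \<union> B)" "B \<in> components (A \<union> B)"
    using *[of A B] *[of B A] assms by (auto simp: Un_commute)
  moreover have "C = A \<or> C = B" if "C \<in> components (A \<union> B)" for C
    using that calculation components_eq[OF that] in_components_nonempty[OF that]
      in_components_subset[OF that] by blast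
  ultimately show ?thesis
    by blast
qed

section \<open>The domain as a quotient of a strip\<close>

text \<open>The hyperbolic model: \<open>G\<close> is a covering of \<Omega> by a strip whose deck
  group is generated by the translation by \<open>\<i>\<close>.\<close>

locale strip_covering =
  fixes \<Omega> :: "complex set" and a :: real and G :: "complex \<Rightarrow> complex"
  assumes a_pos: "a > 0"
    and holo: "G holomorphic_on {z. \<bar>Re z\<bar> < a}"
    and surj: "G ` {z. \<bar>Re z\<bar> < a} = \<Omega>"
    and periodic: "\<And>z w. \<bar>Re z\<bar> < a \<Longrightarrow> \<bar>Re w\<bar> < a \<Longrightarrow>
      G z = G w \<longleftrightarrow> (\<exists>m::int. w = z + \<i> * of_int m)"
begin

abbreviation "V \<equiv> {z. \<bar>Re z\<bar> < a}"

lemma open_V: "open V"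
  by (intro open_Collect_less continuous_intros)

text \<open>A choice of preimage without any continuity. Well defined is its class modulo the
  period, in particular \<open>Re (lift x)\<close> and \<open>deriv G (lift x)\<close>.\<close>

definition lift :: "complex \<Rightarrow> complex" where "lift = inv_into V G"

lemma lift: "x \<in> \<Omega> \<Longrightarrow> lift x \<in> V" "x \<in> \<Omega> \<Longrightarrow> G (lift x) = x"
  using surj inv_into_into[of x G V] f_inv_into_f[of x G V] by (auto simp: lift_def)

lemma lift_G:
  assumes "z \<in> V" obtains m :: int where "lift (G z) = z + \<i> * of_int m"
  using assms lift[of "G z"] periodic[of z "lift (G z)"] surj by fastforce

lemma Re_lift_G [simp]: "z \<in> V \<Longrightarrow> Re (lift (G z)) = Re z"
  by (rule lift_G[of z]) auto

lemma deriv_G_lift_G: assumes "z \<in> V" shows "deriv G (lift (G z)) = deriv G z"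
proof -
  obtain m :: int where m: "lift (G z) = z + \<i> * of_int m"
    using lift_G[OF assms] .
  have "(G has_field_derivative deriv G (lift (G z))) (at (z + \<i> * of_int m))"
    using holomorphic_derivI[OF holo open_V, of "lift (G z)"] assms m by simp
  then have "((\<lambda>w. G (w + \<i> * of_int m)) has_field_derivative deriv G (lift (G z))) (at z)"
    by (simp add: DERIV_shift)
  then have "(G has_field_derivative deriv G (lift (G z))) (at z)"
  proof (rule has_field_derivative_transform_within_open[OF _ open_V assms])
    show "G (w + \<i> * of_int m) = G w" if "w \<in> V" for w
      using that periodic[of w "w + \<i> * of_int m"] by auto
  qed
  then show ?thesis
    by (simp add: DERIV_imp_deriv)
qed

lemma local_inverse:
  assumes "z \<in> V"
  obtains U k where "open U" "G z \<in> U" "U \<subseteq> \<Omega>" "k holomorphic_on U" "k (G z) = z"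
    "k ` U \<subseteq> V" "\<And>x. x \<in> U \<Longrightarrow> G (k x) = x" "deriv k (G z) = 1 / deriv G z" "deriv G z \<noteq> 0"
proof -
  \<comment> \<open>Two points of a ball of radius 1/2 are at distance less than 1, while distinct
    points with the same image differ by a nonzero integer multiple of \<open>\<i>\<close>. Hence
    \<open>G\<close> is injective on \<open>W\<close>.\<close>
  define W where "W = V \<inter> ball z (1/2)"
  have W: "open W" "z \<in> W" "W \<subseteq> V" "G holomorphic_on W"
    using assms open_V holo by (auto simp: W_def intro: holomorphic_on_subset)
  have inj: "inj_on G W"
  proof (rule inj_onI)
    fix x y assume xy: "x \<in> W" "y \<in> W" "G x = G y"
    then obtain m :: int where m: "y = x + \<i> * of_int m"
      using periodic[of x y] by (auto simp: W_def)
    have "dist x y < 1"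
      using xy dist_triangle_half_l[of x z 1 y] by (auto simp: W_def dist_commute)
    then have "\<bar>real_of_int m\<bar> < 1"
      by (simp add: m dist_norm norm_mult)
    then show "x = y"
      using m by simp
  qed
  obtain k where k: "k holomorphic_on (G ` W)" 
    "\<And>w. w \<in> W \<Longrightarrow> deriv G w * deriv k (G w) = 1" "\<And>w. w \<in> W \<Longrightarrow> k (G w) = w"
    using holomorphic_has_inverse[OF W(4,1) inj] by metis
  have "open (G ` W)"
    by (rule open_mapping_thm3[OF W(4,1) inj])
  moreover have nz: "deriv G z \<noteq> 0"
    by (rule holomorphic_injective_imp_regular[OF W(4,1) inj W(2)])
  moreover have "deriv k (G z) = 1 / deriv G z"
    using k(2)[OF W(2)] nz by (simp add: field_simps)
  ultimately show thesis
    using k W surj by (intro that[of "G ` W" k]) auto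
qed

lemma open_image: "open A \<Longrightarrow> open (G ` (V \<inter> A))"
proof (subst open_subopen, safe)
  fix z assume A: "open A" "z \<in> A" "\<bar>Re z\<bar> < a"
  obtain U k where k: "open U" "G z \<in> U" "U \<subseteq> \<Omega>" "k holomorphic_on U" "k (G z) = z"
    "k ` U \<subseteq> V" "\<And>x. x \<in> U \<Longrightarrow> G (k x) = x"
    by (rule local_inverse[of z]) (use A in auto)
  have "open (U \<inter> k -` A)"
    using continuous_open_preimage[OF holomorphic_on_imp_continuous_on[OF k(4)] k(1) A(1)] .
  moreover have "U \<inter> k -` A \<subseteq> G ` (V \<inter> A)"
  proof
    fix x assume "x \<in> U \<inter> k -` A"
    then show "x \<in> G ` (V \<inter> A)"
      using k(6) k(7)[of x] by (intro image_eqI[where x = "k x"]) auto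
  qed
  ultimately show "\<exists>T. open T \<and> G z \<in> T \<and> T \<subseteq> G ` (V \<inter> A)"
    using k A by (intro exI[of _ "U \<inter> k -` A"]) auto
qed

lemma open_\<Omega>: "open \<Omega>"
  using open_image[of UNIV] surj by simp

section \<open>The curve as the image of the axis of the strip\<close>

definition \<gamma> :: "real \<Rightarrow> complex" where "\<gamma> t = G (\<i> * of_real t)"

lemma \<gamma>_has_derivative:
  "(\<gamma> has_vector_derivative deriv G (\<i> * of_real t) * \<i>) (at t)"
proof -
  have "(G has_field_derivative deriv G (\<i> * of_real t)) (at (\<i> * of_real t))"
    using holomorphic_derivI[OF holo open_V] a_pos by simp
  then have "((\<lambda>z. G (\<i> * z)) has_field_derivative deriv G (\<i> * of_real t) * \<i>) (at (of_real t))"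
    by (auto intro!: derivative_eq_intros DERIV_chain2[where f=G])
  then show ?thesis
    unfolding \<gamma>_def by (rule has_vector_derivative_real_field)
qed

lemma deriv_G_nz: "z \<in> V \<Longrightarrow> deriv G z \<noteq> 0"
  by (rule local_inverse)

lemma smooth_simple_closed_curve: "smooth_simple_closed_curve \<gamma>"
proof -
  have line: "\<i> * of_real t \<in> V" for t
    using a_pos by simp
  have eq: "\<gamma> s = \<gamma> t \<longleftrightarrow> (\<exists>m::int. t = s + m)" for s t
  proof -
    have "\<i> * of_real t = \<i> * of_real s + \<i> * of_int m \<longleftrightarrow> t = s + of_int m" for m :: int
      by (auto simp: complex_eq_iff)
    then show ?thesis
      using periodic[of "\<i> * of_real s" "\<i> * of_real t"] a_pos by (simp add: \<gamma>_def)
  qed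
  have "smooth_on \<gamma> UNIV"
    using smooth_on_comp_imaginary_line[OF holo open_V line] by (simp add: \<gamma>_def[abs_def])
  moreover have "path \<gamma>"
    using \<gamma>_has_derivative unfolding path_def
    by (meson continuous_at_imp_continuous_on has_vector_derivative_continuous)
  moreover have "loop_free \<gamma>"
    unfolding loop_free_def
  proof (intro ballI impI)
    fix x y :: real assume xy: "x \<in> {0..1}" "y \<in> {0..1}" "\<gamma> x = \<gamma> y"
    then obtain m :: int where m: "y = x + m"
      using eq by auto
    \<comment> \<open>Parameters in [0,1] differ by at most 1; a shift by 1 in either direction is
      the permitted coincidence of the two ends.\<close>
    then have "m = 0 \<or> m = 1 \<or> m = -1"
      using xy by auto
    then show "x = y \<or> x = 0 \<and> y = 1 \<or> x = 1 \<and> y = 0"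
      using m xy by auto
  qed
  moreover have "\<gamma> (t + 1) = \<gamma> t" for t
    using eq[of t "t + 1"] by (metis of_int_1)
  moreover have "vector_derivative \<gamma> (at t) \<noteq> 0" for t
    using vector_derivative_at[OF \<gamma>_has_derivative] deriv_G_nz[OF line] by simp
  moreover have "pathfinish \<gamma> = pathstart \<gamma>"
    using calculation(4)[of 0] by (simp add: pathfinish_def pathstart_def)
  ultimately show ?thesis
    by (auto simp: smooth_simple_closed_curve_def simple_path_def)
qed

lemma path_image_\<gamma>: "path_image \<gamma> = {x \<in> \<Omega>. Re (lift x) = 0}"
proof (intro equalityI subsetI)
  fix x assume "x \<in> path_image \<gamma>"
  then show "x \<in> {x \<in> \<Omega>. Re (lift x) = 0}"
    using a_pos surj by (auto simp: path_image_def \<gamma>_def)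
next
  fix x assume x: "x \<in> {x \<in> \<Omega>. Re (lift x) = 0}"
  \<comment> \<open>Subtracting the integer part of the imaginary part moves the lift within its
    class into one period.\<close>
  define t where "t = frac (Im (lift x))"
  have "lift x = \<i> * of_real t + \<i> * of_int \<lfloor>Im (lift x)\<rfloor>"
    using x by (simp add: complex_eq_iff t_def frac_def)
  then have "\<gamma> t = x"
    using periodic[of "\<i> * of_real t" "lift x"] x a_pos lift[of x] by (auto simp: \<gamma>_def)
  moreover have "t \<in> {0..1}"
    using frac_lt_1[of "Im (lift x)"] by (simp add: t_def less_imp_le)
  ultimately show "x \<in> path_image \<gamma>"
    by (auto simp: path_image_def)
qed

section \<open>The harmonic measure and the two sides of the curve\<close>

text \<open>The value is independent of the chosen lift because the period \<open>\<i>\<close>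
  leaves the real part unchanged. The default 0 outside \<Omega> supplies the boundary values, as
  \<Omega> is open.\<close>

definition H :: "complex \<Rightarrow> real" where
  "H x = (if x \<in> \<Omega> then 1 - \<bar>Re (lift x)\<bar> / a else 0)"

definition \<Omega>p :: "complex set" where "\<Omega>p = {x \<in> \<Omega>. Re (lift x) > 0}"
definition \<Omega>m :: "complex set" where "\<Omega>m = {x \<in> \<Omega>. Re (lift x) < 0}"

lemma image_Re: "G ` {z \<in> V. P (Re z)} = {x \<in> \<Omega>. P (Re (lift x))}"
proof (intro equalityI subsetI)
  fix x assume "x \<in> {x \<in> \<Omega>. P (Re (lift x))}"
  then show "x \<in> G ` {z \<in> V. P (Re z)}"
    using lift[of x] by (intro image_eqI[where x = "lift x"]) auto
qed (use surj in auto)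

lemma \<Omega>p_eq: "\<Omega>p = G ` {z. 0 < Re z \<and> Re z < a}"
proof -
  have "{z \<in> V. Re z > 0} = {z. 0 < Re z \<and> Re z < a}"
    by auto
  then show ?thesis
    using image_Re[of "\<lambda>r. r > 0"] by (simp add: \<Omega>p_def)
qed

lemma \<Omega>m_eq: "\<Omega>m = G ` {z. - a < Re z \<and> Re z < 0}"
proof -
  have "{z \<in> V. Re z < 0} = {z. - a < Re z \<and> Re z < 0}"
    by auto
  then show ?thesis
    using image_Re[of "\<lambda>r. r < 0"] by (simp add: \<Omega>m_def)
qed

lemma open_\<Omega>p: "open \<Omega>p" and open_\<Omega>m: "open \<Omega>m"
proof -
  have "V \<inter> {z. Re z > 0} = {z. 0 < Re z \<and> Re z < a}" "V \<inter> {z. Re z < 0} = {z. - a < Re z \<and> Re z < 0}"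
    by auto
  then show "open \<Omega>p" "open \<Omega>m"
    using open_image[OF open_halfspace_Re_gt[of 0]] open_image[OF open_halfspace_Re_lt[of 0]]
    by (simp_all add: \<Omega>p_eq \<Omega>m_eq)
qed

text \<open>Each side is the image of a convex half of the strip, hence connected; both are open,
  disjoint and nonempty.\<close>

lemma components: "components (\<Omega> - path_image \<gamma>) = {\<Omega>m, \<Omega>p}" and \<Omega>m_neq_\<Omega>p: "\<Omega>m \<noteq> \<Omega>p"
proof -
  have convex: "convex {z. b < Re z \<and> Re z < c}" for b c
    using convex_Int[OF convex_halfspace_Re_gt convex_halfspace_Re_lt] by (simp add: Collect_conj_eq)
  have "connected (G ` {z. b < Re z \<and> Re z < c})" if "- a \<le> b" "c \<le> a" for b c
    by (intro connected_continuous_image convex_connected convex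
        continuous_on_subset[OF holomorphic_on_imp_continuous_on[OF holo]]) (use that in auto)
  then have "connected \<Omega>p" "connected \<Omega>m"
    using a_pos by (auto simp: \<Omega>p_eq \<Omega>m_eq)
  moreover have "of_real (a/2) \<in> {z. 0 < Re z \<and> Re z < a}" "of_real (-a/2) \<in> {z. -a < Re z \<and> Re z < 0}"
    using a_pos by auto
  then have ne: "\<Omega>p \<noteq> {}" "\<Omega>m \<noteq> {}"
    unfolding \<Omega>p_eq \<Omega>m_eq by blast+
  moreover have disj: "\<Omega>m \<inter> \<Omega>p = {}"
    by (auto simp: \<Omega>m_def \<Omega>p_def)
  moreover have "\<Omega> - path_image \<gamma> = \<Omega>m \<union> \<Omega>p"
    unfolding path_image_\<gamma> by (auto simp: \<Omega>m_def \<Omega>p_def)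
  ultimately show "components (\<Omega> - path_image \<gamma>) = {\<Omega>m, \<Omega>p}"
    using components_Un_open open_\<Omega>p open_\<Omega>m by metis
  show "\<Omega>m \<noteq> \<Omega>p"
    using ne disj by auto
qed

text \<open>The lift may jump by multiples of \<open>\<i>\<close>, but its real part agrees near
  \<open>x\<close> with that of a holomorphic local inverse of \<open>G\<close>. Harmonicity and
  derivatives are computed from the latter.\<close>

lemma Re_lift_local:
  assumes "x \<in> \<Omega>"
  obtains U k where "open U" "x \<in> U" "U \<subseteq> \<Omega>" "k holomorphic_on U" "\<And>y. y \<in> U \<Longrightarrow> Re (lift y) = Re (k y)"
    "deriv k x = 1 / deriv G (lift x)"
proof -
  obtain U k where k: "open U" "G (lift x) \<in> U" "U \<subseteq> \<Omega>" "k holomorphic_on U"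
    "k (G (lift x)) = lift x" "k ` U \<subseteq> V" "\<And>x. x \<in> U \<Longrightarrow> G (k x) = x"
    "deriv k (G (lift x)) = 1 / deriv G (lift x)" "deriv G (lift x) \<noteq> 0"
    by (rule local_inverse[OF lift(1)[OF assms]], rule that)
  have "Re (lift y) = Re (k y)" if "y \<in> U" for y
    using Re_lift_G[of "k y"] k(6) k(7)[OF that] that by (simp add: image_subset_iff)
  then show thesis
    using k(1-4,8) lift(2)[OF assms] by (intro that[of U k]) simp_all
qed

text \<open>This is properness of \<open>G\<close> modulo its period: the points of \<Omega> with
  \<open>H y \<ge> e\<close> lie in the image of one compact rectangle. That image is a compact
  subset of \<Omega>, so it stays away from the frontier point.\<close>

lemma H_near_frontier:
  assumes "x \<in> frontier \<Omega>" "e > 0"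
  shows "\<forall>\<^sub>F y in at x within closure \<Omega>. H y < e"
proof -
  \<comment> \<open>One period of the closed strip where
    \<open>1 - \<bar>Re z\<bar> / a \<ge> e\<close>; for \<open>e > 1\<close> it is empty.\<close>
  define B where "B = cbox (Complex (- a * (1 - e)) 0) (Complex (a * (1 - e)) 1)"
  have B: "B \<subseteq> V"
  proof
    fix z assume "z \<in> B"
    then have "\<bar>Re z\<bar> \<le> a * (1 - e)"
      by (auto simp: B_def in_cbox_complex_iff abs_le_iff)
    also have "\<dots> < a"
      using a_pos \<open>e > 0\<close> by (simp add: algebra_simps)
    finally show "z \<in> V" by simp
  qed
  have "compact (G ` B)"
    using holomorphic_on_imp_continuous_on[OF holo] B
    by (intro compact_continuous_image) (auto simp: B_def intro: continuous_on_subset)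
  then have "open (- (G ` B))"
    using compact_imp_closed by blast
  moreover have "x \<notin> \<Omega>"
    using assms open_\<Omega> by (simp add: frontier_def interior_open)
  then have "x \<in> - (G ` B)"
    using B surj by auto
  ultimately have "\<forall>\<^sub>F y in at x within closure \<Omega>. y \<in> - (G ` B)"
    by (metis eventually_at_topological)
  then show ?thesis
  proof eventually_elim
    case (elim y)
    show ?case
    proof (rule ccontr)
      assume "\<not> H y < e"
      then have y: "y \<in> \<Omega>" "\<bar>Re (lift y)\<bar> \<le> a * (1 - e)"
        using a_pos \<open>e > 0\<close> by (auto simp: H_def field_simps split: if_splits)
      define z where "z = Complex (Re (lift y)) (frac (Im (lift y)))"
      have "z \<in> B"
        using y frac_lt_1[of "Im (lift y)"] by (auto simp: B_def z_def in_cbox_complex_iff less_imp_le)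
      moreover have "lift y = z + \<i> * of_int \<lfloor>Im (lift y)\<rfloor>"
        by (simp add: complex_eq_iff z_def frac_def)
      then have "G z = y"
        using periodic[of z "lift y"] lift[OF y(1)] B \<open>z \<in> B\<close> by auto
      ultimately show False
        using elim by auto
    qed
  qed
qed

lemma H_nonneg: "H x \<ge> 0"
  using lift(1)[of x] a_pos by (auto simp: H_def)

lemma is_harmonic_measure: "is_harmonic_measure \<Omega> (path_image \<gamma>) H"
proof -
  have fr: "H x = 0" if "x \<in> frontier \<Omega>" for x
    using that open_\<Omega> by (simp add: frontier_def interior_open H_def)
  have "continuous (at x within closure \<Omega>) H" if x: "x \<in> closure \<Omega>" for x
  proof (cases "x \<in> \<Omega>")
    case True
    obtain U k where U: "open U" "x \<in> U" "U \<subseteq> \<Omega>" "k holomorphic_on U" "\<And>y. y \<in> U \<Longrightarrow> Re (lift y) = Re (k y)"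
      using Re_lift_local[OF True] by metis
    have "continuous_on U (\<lambda>y. 1 - \<bar>Re (k y)\<bar> / a)"
      using U(4) a_pos by (intro continuous_intros holomorphic_on_imp_continuous_on) auto
    then have "continuous_on U H"
      by (rule continuous_on_eq) (use U in \<open>auto simp: H_def\<close>)
    then show ?thesis
      by (meson U(1,2) continuous_at_imp_continuous_within continuous_on_eq_continuous_at)
  next
    case False
    then have fx: "x \<in> frontier \<Omega>"
      using x open_\<Omega> by (simp add: frontier_def interior_open)
    have "(H \<longlongrightarrow> 0) (at x within closure \<Omega>)"
    proof (rule tendstoI)
      fix e :: real assume "e > 0"
      show "\<forall>\<^sub>F y in at x within closure \<Omega>. dist (H y) 0 < e"
        using H_near_frontier[OF fx \<open>e > 0\<close>] by (simp add: H_nonneg)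
    qed
    then show ?thesis
      by (simp add: continuous_within fr[OF fx])
  qed
  then have cont: "continuous_on (closure \<Omega>) H"
    by (simp add: continuous_on_eq_continuous_within)
  \<comment> \<open>On each side the sign of \<open>Re (lift x)\<close> is constant, which resolves
    the absolute value: \<open>H\<close> is the real part of \<open>1 - k y / a\<close> or of
    \<open>1 + k y / a\<close>.\<close>
  have loc: "\<exists>U f. open U \<and> x \<in> U \<and> f holomorphic_on U \<and> (\<forall>y\<in>U. H y = Re (f y))"
    if x: "x \<in> \<Omega> - path_image \<gamma>" for x
  proof -
    obtain U k where U: "open U" "x \<in> U" "U \<subseteq> \<Omega>" "k holomorphic_on U" "\<And>y. y \<in> U \<Longrightarrow> Re (lift y) = Re (k y)"
      by (rule Re_lift_local[of x]) (use x in auto)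
    show ?thesis
    proof (cases "x \<in> \<Omega>p")
      case True
      show ?thesis
        by (rule exI[of _ "U \<inter> \<Omega>p"], rule exI[of _ "\<lambda>y. 1 - k y / of_real a"])
          (use U True open_\<Omega>p a_pos in \<open>auto simp: H_def \<Omega>p_def intro!: holomorphic_intros intro: holomorphic_on_subset\<close>)
    next
      case False
      then have "x \<in> \<Omega>m"
        using x by (auto simp: path_image_\<gamma> \<Omega>m_def \<Omega>p_def)
      then show ?thesis
        by (intro exI[of _ "U \<inter> \<Omega>m"] exI[of _ "\<lambda>y. 1 + k y / of_real a"])
          (use U open_\<Omega>m a_pos in \<open>auto simp: H_def \<Omega>m_def intro!: holomorphic_intros intro: holomorphic_on_subset\<close>)
    qed
  qed
  have "Ck_on 2 H (\<Omega> - path_image \<gamma>)"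
  proof (rule Ck_on_local)
    fix x assume "x \<in> \<Omega> - path_image \<gamma>"
    from loc[OF this] show "\<exists>U. open U \<and> x \<in> U \<and> Ck_on 2 H U"
      using Ck_on_cong[OF _ Ck_on_Re_holomorphic] by metis
  qed
  moreover have "laplacian H x = 0" if "x \<in> \<Omega> - path_image \<gamma>" for x
    using loc[OF that] laplacian_eq_Re_holomorphic by metis
  moreover have "H x = 1" if "x \<in> path_image \<gamma>" for x
    using that by (simp add: path_image_\<gamma> H_def)
  ultimately show ?thesis
    using cont fr by (simp add: is_harmonic_measure_def)
qed

section \<open>The unit normal and the one-sided derivatives\<close>

text \<open>The derivative of \<open>G\<close> turns the direction 1, in which the real part grows,
  into \<open>deriv G (lift x)\<close>. By conformality this is orthogonal to the tangent
  \<open>deriv G z * \<i>\<close> of the curve.\<close>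

definition n :: "complex \<Rightarrow> complex" where "n x = sgn (deriv G (lift x))"

text \<open>The local inverse has derivative \<open>1 / deriv G (lift x)\<close>; multiplied by the
  normalized \<open>deriv G (lift x)\<close> it leaves the positive number
  \<open>1 / cmod (deriv G (lift x))\<close>.\<close>

lemma Re_lift_normal_derivative:
  assumes "x \<in> \<Omega>"
  shows "((\<lambda>s. Re (lift (x + s *\<^sub>R n x))) has_real_derivative 1 / cmod (deriv G (lift x))) (at 0)"
proof -
  obtain U k where U: "open U" "x \<in> U" "U \<subseteq> \<Omega>" "k holomorphic_on U" "\<And>y. y \<in> U \<Longrightarrow> Re (lift y) = Re (k y)"
    "deriv k x = 1 / deriv G (lift x)"
    using Re_lift_local[OF assms] by metis
  have k: "(k has_derivative (*) (deriv k x)) (at x)"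
    using holomorphic_derivI[OF U(4,1,2)] by (simp add: has_field_derivative_def)
  have "((\<lambda>s. x + s *\<^sub>R n x) has_derivative (\<lambda>s. s *\<^sub>R n x)) (at 0)"
    by (auto intro!: derivative_eq_intros)
  then have "((\<lambda>s. k (x + s *\<^sub>R n x)) has_derivative (\<lambda>s. deriv k x * (s *\<^sub>R n x))) (at 0)"
    by (rule has_derivative_compose) (use k in simp)
  then have *: "((\<lambda>s. Re (k (x + s *\<^sub>R n x))) has_derivative (\<lambda>s. Re (deriv k x * (s *\<^sub>R n x)))) (at 0)"
    by (rule has_derivative_Re)
  have "deriv G (lift x) \<noteq> 0"
    by (rule deriv_G_nz[OF lift(1)[OF assms]])
  then have "Re (deriv k x * (s *\<^sub>R n x)) = 1 / cmod (deriv G (lift x)) * s" for s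
    by (simp add: U(6) n_def sgn_div_norm scaleR_conv_of_real field_simps)
  then have eq: "(\<lambda>s. Re (deriv k x * (s *\<^sub>R n x))) = (*) (1 / cmod (deriv G (lift x)))"
    by (rule ext)
  have "((\<lambda>s. Re (k (x + s *\<^sub>R n x))) has_real_derivative 1 / cmod (deriv G (lift x))) (at 0)"
    using * unfolding has_field_derivative_def eq .
  moreover have "open ((\<lambda>s. x + s *\<^sub>R n x) -` U)"
    by (intro open_vimage U continuous_intros)
  ultimately show ?thesis
    by (rule has_field_derivative_transform_within_open) (use U in auto)
qed

text \<open>The real part of the lift vanishes on the curve and has positive derivative along the
  normal, so it changes sign there from negative to positive.\<close>

lemma eventually_normal:
  assumes "x \<in> path_image \<gamma>"
  shows "\<forall>\<^sub>F s in at_right 0. x + s *\<^sub>R n x \<in> \<Omega>p \<and> x - s *\<^sub>R n x \<in> \<Omega>m"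
proof -
  have x: "x \<in> \<Omega>" "Re (lift x) = 0"
    using assms by (auto simp: path_image_\<gamma>)
  define L where "L = (\<lambda>s. Re (lift (x + s *\<^sub>R n x)))"
  have L: "(L has_real_derivative 1 / cmod (deriv G (lift x))) (at 0)" "L 0 = 0"
    using Re_lift_normal_derivative[OF x(1)] x by (simp_all add: L_def)
  have pos: "1 / cmod (deriv G (lift x)) > 0"
    using deriv_G_nz[OF lift(1)[OF x(1)]] by simp
  obtain d1 where d1: "d1 > 0" "\<And>h. 0 < h \<Longrightarrow> h < d1 \<Longrightarrow> L h > 0"
    using DERIV_pos_inc_right[OF L(1) pos] L(2) by auto
  obtain d2 where d2: "d2 > 0" "\<And>h. 0 < h \<Longrightarrow> h < d2 \<Longrightarrow> L (- h) < 0"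
    using DERIV_pos_inc_left[OF L(1) pos] L(2) by auto
  have "open ((\<lambda>s. x + s *\<^sub>R n x) -` \<Omega>)"
    by (intro open_vimage open_\<Omega> continuous_intros)
  then obtain d3 where "d3 > 0" "ball 0 d3 \<subseteq> (\<lambda>s. x + s *\<^sub>R n x) -` \<Omega>"
    by (rule openE[of _ 0]) (use x(1) in auto)
  then have d3: "d3 > 0" "\<And>s. \<bar>s\<bar> < d3 \<Longrightarrow> x + s *\<^sub>R n x \<in> \<Omega>"
    by (auto simp: subset_iff)
  have "\<forall>\<^sub>F s in at_right 0. s \<in> {0<..<min d1 (min d2 d3)}"
    using d1 d2 d3 by (intro eventually_at_right_real) auto
  then show ?thesis
  proof eventually_elim
    case (elim s)
    then show ?case
      using d1(2)[of s] d2(2)[of s] d3(2)[of s] d3(2)[of "-s"] by (simp add: \<Omega>p_def \<Omega>m_def L_def)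
  qed
qed

lemma is_unit_normal: "is_unit_normal \<gamma> \<Omega>m \<Omega>p n"
  unfolding is_unit_normal_def
proof (intro allI conjI)
  fix t :: real
  have V: "\<i> * of_real t \<in> V"
    using a_pos by simp
  have n: "n (\<gamma> t) = sgn (deriv G (\<i> * of_real t))"
    using deriv_G_lift_G[OF V] by (simp add: n_def \<gamma>_def)
  show "norm (n (\<gamma> t)) = 1"
    using deriv_G_nz[OF V] by (simp add: n norm_sgn)
  show "n (\<gamma> t) \<bullet> vector_derivative \<gamma> (at t) = 0"
    unfolding n vector_derivative_at[OF \<gamma>_has_derivative] by (simp add: sgn_div_norm inner_complex_def)
  have "\<gamma> t \<in> path_image \<gamma>"
    using a_pos surj by (auto simp: path_image_\<gamma> \<gamma>_def)
  then show "\<forall>\<^sub>F s in at_right 0. \<gamma> t + s *\<^sub>R n (\<gamma> t) \<in> \<Omega>p \<and> \<gamma> t - s *\<^sub>R n (\<gamma> t) \<in> \<Omega>m"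
    by (rule eventually_normal)
qed

text \<open>Along the normal \<open>H\<close> is \<open>1 - L s / a\<close> on one side and
  \<open>1 + L s / a\<close> on the other, with one function \<open>L\<close> differentiable across
  the curve. The derivatives are therefore opposite.\<close>

lemma normal_derivatives:
  assumes "x \<in> path_image \<gamma>"
  shows "\<exists>dp dm. has_derivative_from_within H x (n x) \<Omega>p dp \<and>
    has_derivative_from_within H x (n x) \<Omega>m dm \<and> dp + dm = 0"
proof -
  have x: "x \<in> \<Omega>" "Re (lift x) = 0"
    using assms by (auto simp: path_image_\<gamma>)
  define L where "L = (\<lambda>s. Re (lift (x + s *\<^sub>R n x)))"
  define c where "c = 1 / cmod (deriv G (lift x))"
  have L: "(L has_real_derivative c) (at 0 within T)" for T
    using Re_lift_normal_derivative[OF x(1)] unfolding L_def c_def by (rule has_field_derivative_at_within)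
  \<comment> \<open>The parameter 0 corresponds to \<open>x\<close>, which is on the curve and not
    in \<open>\<Omega>p\<close>. It is inserted so that the two functions are also compared at the
    base point, and dropped again by \<open>DERIV_subset\<close>.\<close>
  have "((\<lambda>s. H (x + s *\<^sub>R n x)) has_real_derivative - (c / a)) (at 0 within insert 0 {s. x + s *\<^sub>R n x \<in> \<Omega>p})"
  proof (rule has_field_derivative_transform_within[OF _ zero_less_one])
    show "((\<lambda>s. 1 - L s / a) has_real_derivative - (c / a)) (at 0 within insert 0 {s. x + s *\<^sub>R n x \<in> \<Omega>p})"
      using a_pos by (auto intro!: derivative_eq_intros L)
  qed (use x in \<open>auto simp: H_def L_def \<Omega>p_def\<close>)
  then have "has_derivative_from_within H x (n x) \<Omega>p (- (c / a))"
    unfolding has_derivative_from_within_def by (rule DERIV_subset) auto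
  moreover have "((\<lambda>s. H (x + s *\<^sub>R n x)) has_real_derivative c / a) (at 0 within insert 0 {s. x + s *\<^sub>R n x \<in> \<Omega>m})"
  proof (rule has_field_derivative_transform_within[OF _ zero_less_one])
    show "((\<lambda>s. 1 + L s / a) has_real_derivative c / a) (at 0 within insert 0 {s. x + s *\<^sub>R n x \<in> \<Omega>m})"
      using a_pos by (auto intro!: derivative_eq_intros L)
  qed (use x in \<open>auto simp: H_def L_def \<Omega>m_def\<close>)
  then have "has_derivative_from_within H x (n x) \<Omega>m (c / a)"
    unfolding has_derivative_from_within_def by (rule DERIV_subset) auto
  ultimately show ?thesis
    by force
qed

end

section \<open>Components of the logarithm of the domain\<close>

lemma open_add_exp_image:
  fixes U :: "complex set"
  assumes "open U"
  shows "open ((\<lambda>z. p + exp z) ` U)"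
proof -
  have "\<not> exp constant_on (UNIV :: complex set)"
  proof
    assume "exp constant_on (UNIV :: complex set)"
    then have "exp (0::complex) = exp (of_real pi * \<i>)"
      by (metis constant_on_def UNIV_I)
    then show False
      by simp
  qed
  then have "open (exp ` U)"
    using assms by (intro open_mapping_thm[of exp UNIV]) (auto intro: holomorphic_intros)
  then have "open ((+) p ` exp ` U)"
    by (rule open_translation)
  then show ?thesis
    by (simp add: image_image)
qed

lemma open_add_exp_preimage:
  fixes \<Omega> :: "complex set"
  assumes "open \<Omega>"
  shows "open {z. p + exp z \<in> \<Omega>}"
proof -
  have "continuous_on UNIV (\<lambda>z::complex. p + exp z)"
    by (intro continuous_intros)
  then show ?thesis
    using open_vimage[OF assms] by (simp add: vimage_def)
qed

text \<open>A bounded component would lie in a compact, relatively open subset \<open>K\<close> of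
  the preimage, by the Sura-Bura theorem. The image of \<open>K\<close> is compact and relatively
  open in \<open>C\<close>, so it contains a whole component of \<open>C\<close>. This component is
  bounded and misses \<open>p\<close> because \<open>exp\<close> has no zeros, a
  contradiction.\<close>

lemma unbounded_components_exp_preimage:
  fixes C :: "complex set"
  assumes "closed C" and J: "\<And>J. J \<in> components C \<Longrightarrow> p \<notin> J \<Longrightarrow> \<not> bounded J"
    and D: "D \<in> components {z. p + exp z \<in> C}"
  shows "\<not> bounded D"
proof
  assume "bounded D"
  define E where "E = (\<lambda>z. p + exp z)"
  define F where "F = E -` C"
  have F: "closed F"
    unfolding F_def E_def by (intro closed_vimage \<open>closed C\<close> continuous_intros)
  have D: "D \<in> components F"
    using D by (simp add: F_def E_def vimage_def)
  have "compact D"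
    using closed_components[OF F D] \<open>bounded D\<close> by (simp add: compact_eq_bounded_closed)
  then obtain K where K: "openin (top_of_set F) K" "compact K" "D \<subseteq> K"
    using Sura_Bura_clopen_subset[OF closed_imp_locally_compact[OF F] D _ open_UNIV] by auto
  obtain U where U: "open U" "K = F \<inter> U"
    using K(1) by (auto simp: openin_open)
  have EK: "E ` K = C \<inter> E ` U"
    using U by (auto simp: F_def)
  have cmp: "compact (E ` K)"
    using K(2) unfolding E_def by (intro compact_continuous_image continuous_intros)
  obtain z where z: "z \<in> D"
    using in_components_nonempty[OF D] by auto
  then have "E z \<in> E ` K"
    using K(3) by blast
  then have Ez: "E z \<in> E ` K" "E z \<in> C"
    unfolding EK by auto
  define J where "J = connected_component_set C (E z)"
  have Jc: "J \<in> components C" "E z \<in> J" "J \<subseteq> C" "connected J"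
    using Ez by (auto simp: J_def components_def connected_component_subset)
  have "J \<inter> E ` K = J \<inter> E ` U"
    using Jc(3) EK by auto
  then have "openin (top_of_set J) (J \<inter> E ` K)"
    using open_add_exp_image[OF U(1), of p] by (simp add: openin_open_Int E_def)
  moreover have "closedin (top_of_set J) (J \<inter> E ` K)"
    using compact_imp_closed[OF cmp] by (simp add: closedin_closed_Int)
  ultimately have "J \<inter> E ` K = {} \<or> J \<inter> E ` K = J"
    using Jc(4) connected_clopen by blast
  then have "J \<subseteq> E ` K"
    using Jc(2) Ez(1) by blast
  moreover have "p \<notin> E ` K"
    by (auto simp: E_def)
  ultimately show False
    using J[OF Jc(1)] compact_imp_bounded[OF cmp] bounded_subset by blast
qed

text \<open>The criterion is that no component of the complement of \<open>S\<close> is bounded. A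
  component that meets the complement of \<open>F\<close> contains an unbounded component of that
  complement; one that lies inside \<open>F\<close> is impossible.\<close>

lemma simply_connected_component_exp_preimage:
  fixes \<Omega> :: "complex set"
  assumes "open \<Omega>" "p \<notin> \<Omega>" and J: "\<And>J. J \<in> components (- \<Omega>) \<Longrightarrow> p \<notin> J \<Longrightarrow> \<not> bounded J"
    and S: "S \<in> components {z. p + exp z \<in> \<Omega>}"
  shows "open S" "simply_connected S"
proof -
  define F where "F = {z. p + exp z \<in> \<Omega>}"
  have F: "open F"
    unfolding F_def by (rule open_add_exp_preimage[OF \<open>open \<Omega>\<close>])
  have S: "S \<in> components F"
    using S by (simp add: F_def)
  show "open S"
    by (rule open_components[OF F S])
  have S': "S \<subseteq> F" "connected S" "S \<noteq> {}"
    using in_components_subset[OF S] in_components_connected[OF S] in_components_nonempty[OF S] by auto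
  have Fne: "\<not> bounded D" if "D \<in> components (- F)" for D
    using unbounded_components_exp_preimage[of "- \<Omega>" p D] assms that
    by (auto simp: F_def Collect_neg_eq closed_Compl)
  have hits: "\<not> bounded C" if C: "C \<in> components (- S)" and z: "z \<in> C" "z \<notin> F" for C z
  proof -
    have "connected_component_set (- F) z \<subseteq> C"
    proof (rule components_maximal[OF C])
      show "connected_component_set (- F) z \<subseteq> - S"
        using connected_component_subset[of "- F" z] S' by blast
      show "C \<inter> connected_component_set (- F) z \<noteq> {}"
        using z by auto
    qed auto
    moreover have "\<not> bounded (connected_component_set (- F) z)"
      using z by (intro Fne) (auto simp: components_def)
    ultimately show ?thesis
      using bounded_subset by blast
  qed
  have "\<not> bounded C" if C: "C \<in> components (- S)" for C
  proof
    assume "bounded C"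
    then have CF: "C \<subseteq> F"
      using hits[OF C] by blast
    obtain z where z: "z \<in> C"
      using in_components_nonempty[OF C] by auto
    \<comment> \<open>Another component \<open>T\<close> of \<open>F\<close> meets \<open>C\<close>.
      Its closure avoids the open set \<open>S\<close>, so it stays in \<open>C\<close> and hence in
      \<open>F\<close>, although the nonempty frontier of \<open>T\<close> is disjoint from
      \<open>F\<close>.\<close>
    define T where "T = connected_component_set F z"
    have T: "T \<in> components F" "z \<in> T"
      using z CF by (auto simp: T_def components_def)
    have "z \<notin> S"
      using z in_components_subset[OF C] by auto
    then have "S \<inter> T = {}"
      using components_eq[OF S T(1)] T(2) by auto
    then have disj: "S \<inter> closure T = {}"
      using open_Int_closure_eq_empty[OF \<open>open S\<close>] by simp
    have "closure T \<subseteq> C"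
      using disj z T(2) closure_subset[of T]
      by (intro components_maximal[OF C] connected_imp_connected_closure in_components_connected[OF T(1)]) auto
    moreover have "T \<noteq> UNIV" "T \<noteq> {}"
      using S' \<open>S \<inter> T = {}\<close> T by auto
    then have "frontier T \<noteq> {}"
      by (simp add: frontier_eq_empty)
    moreover have "frontier T \<subseteq> frontier F"
      by (rule frontier_of_components_subset[OF T(1)])
    moreover have "frontier F \<inter> F = {}"
      using F by (auto simp: frontier_def interior_open)
    ultimately show False
      using CF unfolding frontier_def by blast
  qed
  then show "simply_connected S"
    using simply_connected_eq_unbounded_complement_components[OF \<open>open S\<close>] S' by blast
qed

text \<open>Translation by a multiple of \<open>2\<pi>i\<close> preserves the preimage, and the
  translate of \<open>S\<close> is connected; once it meets \<open>S\<close> it lies in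
  \<open>S\<close>.\<close>

lemma components_exp_preimage_shift:
  assumes S: "S \<in> components {z. p + exp z \<in> \<Omega>}" and "z \<in> S" "z + of_int m * (2 * of_real pi * \<i>) \<in> S" "w \<in> S"
  shows "w + of_int m * (2 * of_real pi * \<i>) \<in> S"
proof -
  define c where "c = of_int m * (2 * of_real pi * \<i>)"
  have "exp c = 1"
    unfolding exp_eq_1 c_def by auto
  then have "exp (y + c) = exp y" for y
    by (simp add: exp_add)
  then have "(\<lambda>y. y + c) ` S \<subseteq> S"
    using in_components_subset[OF S] assms
    by (intro components_maximal[OF S] connected_continuous_image in_components_connected[OF S] continuous_intros)
      (auto simp: c_def)
  then show ?thesis
    using \<open>w \<in> S\<close> by (auto simp: c_def)
qed

text \<open>Components with intersecting images are translates of each other by a period of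
  \<open>exp\<close> and have equal images. The images are thus open sets, equal to or disjoint from
  that of \<open>S\<close>, and they cover the connected set \<Omega>.\<close>

lemma image_component_exp_preimage:
  fixes \<Omega> :: "complex set"
  assumes "open \<Omega>" "connected \<Omega>" "p \<notin> \<Omega>" and S: "S \<in> components {z. p + exp z \<in> \<Omega>}"
  shows "(\<lambda>z. p + exp z) ` S = \<Omega>"
proof -
  define E where "E = (\<lambda>z. p + exp z)"
  define F where "F = {z. E z \<in> \<Omega>}"
  have F: "open F"
    unfolding F_def E_def by (rule open_add_exp_preimage[OF \<open>open \<Omega>\<close>])
  have S: "S \<in> components F"
    using S by (simp add: F_def E_def)
  have openE: "open (E ` U)" if "open U" for U
    unfolding E_def by (rule open_add_exp_image[OF that])
  have eq: "E ` S = E ` T" if T: "T \<in> components F" and ne: "E ` S \<inter> E ` T \<noteq> {}" for T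
  proof -
    obtain z w where zw: "z \<in> S" "w \<in> T" "E z = E w"
      using ne by auto
    then obtain m :: int where m: "z = w + (of_int (2 * m) * pi) * \<i>"
      by (auto simp: E_def exp_eq)
    define c where "c = of_int (2 * m) * of_real pi * \<i>"
    have c: "exp c = 1"
      unfolding exp_eq_1 c_def by auto
    then have per: "E (y + c) = E y" "E (y - c) = E y" for y
      by (simp_all add: E_def exp_add exp_diff)
    have sub: "(\<lambda>y. y + d) ` B \<subseteq> A"
      if "A \<in> components F" "B \<in> components F" "b \<in> B" "b + d \<in> A" "\<And>y. E (y + d) = E y" for A B b d
    proof (rule components_maximal[OF that(1)])
      show "connected ((\<lambda>y. y + d) ` B)"
        by (intro connected_continuous_image in_components_connected[OF that(2)] continuous_intros)
      show "(\<lambda>y. y + d) ` B \<subseteq> F"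
        using in_components_subset[OF that(2)] that(5) by (auto simp: F_def)
      show "A \<inter> (\<lambda>y. y + d) ` B \<noteq> {}"
        using that by blast
    qed
    have "(\<lambda>y. y + c) ` T \<subseteq> S"
      by (rule sub[OF S T zw(2)]) (use m zw per in \<open>auto simp: c_def\<close>)
    moreover have "(\<lambda>y. y + - c) ` S \<subseteq> T"
      by (rule sub[OF T S zw(1)]) (use m zw per in \<open>auto simp: c_def\<close>)
    ultimately show ?thesis
      using per unfolding image_subset_iff by (smt (verit, best) add_uminus_conv_diff image_iff subsetI subset_antisym)
  qed
  define R where "R = \<Union> {E ` T |T. T \<in> components F \<and> E ` S \<inter> E ` T = {}}"
  have "open R"
    unfolding R_def by (intro open_Union) (use openE open_components[OF F] in auto)
  have "\<Omega> \<subseteq> E ` S \<union> R"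
  proof
    fix x assume "x \<in> \<Omega>"
    define z where "z = Ln (x - p)"
    have "x - p \<noteq> 0"
      using \<open>x \<in> \<Omega>\<close> \<open>p \<notin> \<Omega>\<close> by auto
    then have z: "E z = x"
      by (simp add: E_def z_def exp_Ln)
    define T where "T = connected_component_set F z"
    have T: "T \<in> components F" "z \<in> T"
      using \<open>x \<in> \<Omega>\<close> z by (auto simp: T_def components_def F_def)
    then have "x \<in> E ` T"
      using z by auto
    then show "x \<in> E ` S \<union> R"
      using eq[OF T(1)] T(1) unfolding R_def by (cases "E ` S \<inter> E ` T = {}") auto
  qed
  moreover have "E ` S \<subseteq> \<Omega>" "R \<subseteq> \<Omega>"
    using in_components_subset unfolding R_def F_def using S F_def by blast+
  moreover have "E ` S \<inter> R = {}"
    unfolding R_def by blast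
  moreover have "E ` S \<noteq> {}"
    using in_components_nonempty[OF S] by auto
  ultimately have "R = {}"
    using connectedD[OF \<open>connected \<Omega>\<close> openE[OF open_components[OF F S]] \<open>open R\<close>] by blast
  then show ?thesis
    using \<open>\<Omega> \<subseteq> E ` S \<union> R\<close> \<open>E ` S \<subseteq> \<Omega>\<close> by (auto simp: E_def)
qed

section \<open>The translations preserving a component\<close>

text \<open>Division with remainder by the least positive element; the remainder lies in
  \<open>M\<close> again and must vanish.\<close>

lemma subgroup_int_generator:
  fixes M :: "int set"
  assumes "\<exists>m\<in>M. m \<noteq> 0" and diff: "\<And>a b. a \<in> M \<Longrightarrow> b \<in> M \<Longrightarrow> a - b \<in> M"
  obtains k where "k > 0" "\<And>m. m \<in> M \<longleftrightarrow> k dvd m"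
proof -
  have 0: "0 \<in> M"
    using assms by fastforce
  then have minus: "- a \<in> M" if "a \<in> M" for a
    using diff[of 0 a] that by simp
  have add: "a + b \<in> M" if "a \<in> M" "b \<in> M" for a b
    using diff[of a "- b"] minus that by simp
  have mult: "c * a \<in> M" if a: "a \<in> M" for a c
  proof (induction c rule: int_induct[where k = 0])
    case base
    show ?case using 0 by simp
  next
    case (step1 i)
    show ?case using add[OF step1(2) a] by (simp add: algebra_simps)
  next
    case (step2 i)
    show ?case using diff[OF step2(2) a] by (simp add: algebra_simps)
  qed
  obtain m where "m \<in> M" "m \<noteq> 0"
    using assms by auto
  then have ex: "\<exists>n::nat. n > 0 \<and> int n \<in> M"
    using minus[of m] by (intro exI[of _ "nat \<bar>m\<bar>"]) (auto simp: abs_if)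
  define n where "n = (LEAST n::nat. n > 0 \<and> int n \<in> M)"
  have n: "n > 0" "int n \<in> M"
    using LeastI_ex[OF ex] by (auto simp: n_def)
  have "int n dvd m" if "m \<in> M" for m
  proof (rule ccontr)
    assume "\<not> int n dvd m"
    then have "m mod int n \<noteq> 0"
      by (simp add: mod_eq_0_iff_dvd)
    then have r: "0 < m mod int n" "m mod int n < int n"
      using n(1) pos_mod_bound[of "int n" m] pos_mod_sign[of "int n" m] by linarith+
    have "m mod int n \<in> M"
      using diff[OF that mult[OF n(2), of "m div int n"]] by (simp add: minus_div_mult_eq_mod)
    then have "n \<le> nat (m mod int n)"
      using Least_le[of "\<lambda>n. n > 0 \<and> int n \<in> M" "nat (m mod int n)"] r by (simp add: n_def[symmetric])
    then show False
      using r by linarith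
  qed
  moreover have "m \<in> M" if "int n dvd m" for m
    using that mult[OF n(2)] by (metis dvd_def mult.commute)
  ultimately show thesis
    using n(1) by (intro that[of "int n"]) auto
qed

text \<open>\<open>P\<close> generates the group of those multiples of \<open>2\<pi>i\<close> that
  preserve \<open>S\<close>. By \<open>components_exp_preimage_shift\<close> this group accounts for
  every coincidence of \<open>exp\<close> on \<open>S\<close>.\<close>

lemma component_exp_preimage_stabilizer:
  fixes \<Omega> :: "complex set"
  assumes "open \<Omega>" "connected \<Omega>" "p \<notin> \<Omega>" "\<not> simply_connected \<Omega>"
    and J: "\<And>J. J \<in> components (- \<Omega>) \<Longrightarrow> p \<notin> J \<Longrightarrow> \<not> bounded J"
    and S: "S \<in> components {z. p + exp z \<in> \<Omega>}"
  obtains P where "P \<noteq> 0" "\<And>z. z \<in> S \<Longrightarrow> z + P \<in> S" "\<And>z. z \<in> S \<Longrightarrow> z - P \<in> S"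
    "\<And>z w. z \<in> S \<Longrightarrow> w \<in> S \<Longrightarrow> exp z = exp w \<longleftrightarrow> (\<exists>j::int. w = z + of_int j * P)"
proof -
  define c where "c = 2 * of_real pi * \<i>"
  have c: "c \<noteq> 0"
    by (simp add: c_def)
  have exp_eq': "exp z = exp w \<longleftrightarrow> (\<exists>m::int. w = z + of_int m * c)" for z w
    unfolding exp_eq[of w z, THEN eq_commute[THEN trans]] by (simp add: c_def mult_ac)
  define M where "M = {m::int. \<forall>z\<in>S. z + of_int m * c \<in> S}"
  have M: "m \<in> M" if "z \<in> S" "z + of_int m * c \<in> S" for z m
    using components_exp_preimage_shift[OF S that(1)] that(2) by (auto simp: M_def c_def)
  obtain z0 where z0: "z0 \<in> S"
    using in_components_nonempty[OF S] by auto
  \<comment> \<open>With a trivial group \<open>exp\<close> would be injective on \<open>S\<close>,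
    and by invariance of domain \<Omega> would be homeomorphic to the simply connected set
    \<open>S\<close>.\<close>
  have "\<exists>m\<in>M. m \<noteq> 0"
  proof (rule ccontr)
    assume *: "\<not> ?thesis"
    have inj: "inj_on (\<lambda>z. p + exp z) S"
    proof (rule inj_onI)
      fix z w assume zw: "z \<in> S" "w \<in> S" "p + exp z = p + exp w"
      then obtain m :: int where m: "w = z + of_int m * c"
        using exp_eq' by auto
      then show "z = w"
        using M[OF zw(1), of m] zw(2) * by auto
    qed
    have "S homeomorphic (\<lambda>z. p + exp z) ` S"
    proof (rule invariance_of_domain_homeomorphic[OF simply_connected_component_exp_preimage(1)[OF assms(1,3) J S]])
      show "continuous_on S (\<lambda>z. p + exp z)"
        by (intro continuous_intros)
    qed (use inj in auto)
    then show False
      using simply_connected_component_exp_preimage(2)[OF assms(1,3) J S] \<open>\<not> simply_connected \<Omega>\<close>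
        homeomorphic_simply_connected_eq image_component_exp_preimage[OF assms(1-3) S] by metis
  qed
  moreover have "a - b \<in> M" if "a \<in> M" "b \<in> M" for a b
  proof -
    have minus: "- b \<in> M"
      using M[of "z0 + of_int b * c" "- b"] z0 that by (auto simp: M_def)
    then have "z0 + of_int (- b) * c + of_int a * c \<in> S"
      using z0 that unfolding M_def by blast
    then show ?thesis
      using M[OF z0, of "a - b"] by (simp add: algebra_simps)
  qed
  ultimately obtain k where k: "k > 0" "\<And>m. m \<in> M \<longleftrightarrow> k dvd m"
    using subgroup_int_generator by metis
  have "k \<in> M" "- k \<in> M"
    by (simp_all add: k)
  then have shift: "z + of_int k * c \<in> S" "z - of_int k * c \<in> S" if "z \<in> S" for z
    using that by (auto simp: M_def)
  moreover have "exp z = exp w \<longleftrightarrow> (\<exists>j::int. w = z + of_int j * (of_int k * c))" if "z \<in> S" "w \<in> S" for z w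
  proof
    assume "exp z = exp w"
    then obtain m :: int where m: "w = z + of_int m * c"
      using exp_eq' by auto
    then have "k dvd m"
      using M[OF that(1)] that(2) k(2) by auto
    then show "\<exists>j::int. w = z + of_int j * (of_int k * c)"
      using m by (auto simp: dvd_def mult_ac)
  next
    assume "\<exists>j::int. w = z + of_int j * (of_int k * c)"
    then show "exp z = exp w"
      unfolding exp_eq' by (metis mult.assoc of_int_mult)
  qed
  ultimately show thesis
    using k(1) c by (intro that[of "of_int k * c"]) auto
qed

section \<open>Automorphisms of the disc without fixed points\<close>

text \<open>The Schwarz lemma for \<open>f\<close> and for its inverse gives equality of norms, and
  the equality case is a rotation.\<close>

lemma disc_automorphism_fixing_0:
  assumes "f holomorphic_on ball 0 1" "g holomorphic_on ball 0 1"
    and "f ` ball 0 1 \<subseteq> ball 0 1" "g ` ball 0 1 \<subseteq> ball 0 1"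
    and "\<And>z. z \<in> ball 0 1 \<Longrightarrow> g (f z) = z" and "f 0 = 0"
  obtains u where "cmod u = 1" "\<And>z. z \<in> ball 0 1 \<Longrightarrow> f z = u * z"
proof -
  have "g 0 = 0"
    using assms(5)[of 0] \<open>f 0 = 0\<close> by simp
  have f: "norm (f z) < 1" and g: "norm (g z) < 1" if "norm z < 1" for z
    using that assms by (auto simp: image_subset_iff)
  have "norm (f z) = norm z" if "norm z < 1" for z
    using Schwarz_Lemma(1)[OF assms(1) \<open>f 0 = 0\<close> f that]
      Schwarz_Lemma(1)[OF assms(2) \<open>g 0 = 0\<close> g f[OF that]] assms(5)[of z] that by simp
  then have "\<exists>z. norm z < 1 \<and> z \<noteq> 0 \<and> norm (f z) = norm z"
    by (intro exI[of _ "1/2"]) auto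
  then obtain u where "\<forall>z. norm z < 1 \<longrightarrow> f z = u * z" "norm u = 1"
    using Schwarz_Lemma(3)[OF assms(1) \<open>f 0 = 0\<close> f, of 0] by auto
  then show thesis
    using that by auto
qed

lemma one_minus_cnj_mult_nz:
  assumes "cmod b < 1" "cmod z \<le> 1"
  shows "1 - cnj b * z \<noteq> 0"
proof
  assume "1 - cnj b * z = 0"
  then have "cmod (cnj b * z) = 1"
    by (metis eq_iff_diff_eq_0 norm_one)
  moreover have "cmod (cnj b * z) \<le> cmod b * 1"
    unfolding norm_mult complex_mod_cnj by (intro mult_left_mono assms) auto
  ultimately show False
    using assms by simp
qed

text \<open>Followed by the Moebius map that takes \<open>f 0\<close> to 0, \<open>f\<close> fixes 0
  and is a rotation. Solving for \<open>f z\<close> gives a Moebius map, stated with its denominator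
  cleared.\<close>

lemma disc_automorphism:
  assumes "f holomorphic_on ball 0 1" "g holomorphic_on ball 0 1"
    and "f ` ball 0 1 \<subseteq> ball 0 1" "g ` ball 0 1 \<subseteq> ball 0 1"
    and "\<And>z. z \<in> ball 0 1 \<Longrightarrow> g (f z) = z"
  obtains u b where "cmod u = 1" "cmod b < 1"
    "\<And>z. z \<in> ball 0 1 \<Longrightarrow> f z * (1 + u * cnj b * z) = u * z + b"
proof -
  define b where "b = f 0"
  have b: "cmod b < 1"
    using assms(3) by (simp add: b_def image_subset_iff)
  define M where "M = Moebius_function 0 b"
  define N where "N = Moebius_function 0 (- b)"
  have M: "M holomorphic_on ball 0 1" "M ` ball 0 1 \<subseteq> ball 0 1"
    and N: "N holomorphic_on ball 0 1" "N ` ball 0 1 \<subseteq> ball 0 1"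
    using b Moebius_function_holomorphic Moebius_function_norm_lt_1 by (auto simp: M_def N_def)
  have NM: "N (M z) = z" if "z \<in> ball 0 1" for z
    using that b Moebius_function_compose by (auto simp: M_def N_def)
  obtain u where u: "cmod u = 1" "\<And>z. z \<in> ball 0 1 \<Longrightarrow> (M \<circ> f) z = u * z"
  proof (rule disc_automorphism_fixing_0[of "M \<circ> f" "g \<circ> N"])
    show "M \<circ> f holomorphic_on ball 0 1" "g \<circ> N holomorphic_on ball 0 1"
      using assms M N by (auto intro!: holomorphic_on_compose_gen)
    show "(M \<circ> f) ` ball 0 1 \<subseteq> ball 0 1" "(g \<circ> N) ` ball 0 1 \<subseteq> ball 0 1"
      using assms(3,4) M(2) N(2) unfolding image_subset_iff o_def by blast+
    show "(g \<circ> N) ((M \<circ> f) z) = z" if "z \<in> ball 0 1" for z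
      using NM[of "f z"] assms(3,5) that by (auto simp: image_subset_iff)
    show "(M \<circ> f) 0 = 0"
      by (simp add: M_def b_def Moebius_function_eq_zero)
  qed (rule that)
  have "f z * (1 + u * cnj b * z) = u * z + b" if "z \<in> ball 0 1" for z
  proof -
    have "f z \<in> ball 0 1"
      using that assms(3) by blast
    then have "1 - cnj b * f z \<noteq> 0"
      using one_minus_cnj_mult_nz[OF b, of "f z"] by simp
    moreover have "(f z - b) / (1 - cnj b * f z) = u * z"
      using u(2)[OF that] by (simp add: M_def Moebius_function_simple)
    ultimately have "f z - b = u * z * (1 - cnj b * f z)"
      by (simp add: divide_simps)
    then show ?thesis
      by (simp add: algebra_simps)
  qed
  then show thesis
    using that u(1) b by blast
qed

text \<open>The reflection in the unit circle maps fixed points of a disc automorphism to fixed points,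
  so an automorphism without fixed points in the disc has all its fixed points on the circle.\<close>

lemma disc_automorphism_boundary_fixed_point:
  assumes "cmod u = 1" "cmod b < 1"
    and no_fix: "\<And>z. cmod z < 1 \<Longrightarrow> u * z + b \<noteq> z * (1 + u * cnj b * z)"
  obtains \<zeta> where "cmod \<zeta> = 1" "u * \<zeta> + b = \<zeta> * (1 + u * cnj b * \<zeta>)"
proof -
  have nz: "u \<noteq> 0" "b \<noteq> 0"
    using assms(1) no_fix[of 0] by auto
  define c where "c = u * cnj b"
  have c: "c \<noteq> 0"
    using nz by (simp add: c_def)
  \<comment> \<open>A square root of the discriminant of
    \<open>c * \<zeta>\<^sup>2 + (1 - u) * \<zeta> - b = 0\<close>, the fixed point equation as a
    quadratic in \<zeta>.\<close>
  define d where "d = csqrt ((1 - u)\<^sup>2 + 4 * c * b)"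
  define \<zeta> where "\<zeta> = (d - (1 - u)) / (2 * c)"
  have "d\<^sup>2 = (1 - u)\<^sup>2 + 4 * c * b"
    by (simp add: d_def)
  moreover have "d = 2 * c * \<zeta> + (1 - u)"
    using c by (simp add: \<zeta>_def)
  ultimately have "4 * c * (c * \<zeta>\<^sup>2 + (1 - u) * \<zeta> - b) = 0"
    by (simp add: power2_eq_square algebra_simps)
  then have "c * \<zeta>\<^sup>2 + (1 - u) * \<zeta> - b = 0"
    using c by simp
  then have fixed: "u * \<zeta> + b = \<zeta> * (1 + u * cnj b * \<zeta>)"
    by (simp add: c_def algebra_simps power2_eq_square)
  then have ge: "cmod \<zeta> \<ge> 1"
    using no_fix[of \<zeta>] by linarith
  then have \<zeta>0: "cnj \<zeta> \<noteq> 0"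
    by auto
  have l: "u * cnj u = 1"
    using assms(1) by (simp add: complex_norm_square[symmetric])
  define \<eta> where "\<eta> = 1 / cnj \<zeta>"
  have \<eta>: "cnj \<zeta> * \<eta> = 1"
    using \<zeta>0 by (simp add: \<eta>_def)
  have "cnj (u * \<zeta> + b) = cnj (\<zeta> * (1 + u * cnj b * \<zeta>))"
    using fixed by simp
  then have "cnj u * cnj \<zeta> + cnj b = cnj \<zeta> * (1 + cnj u * b * cnj \<zeta>)"
    by simp
  \<comment> \<open>The factor \<open>u * \<eta>\<^sup>2\<close> turns the conjugated equation for
    \<zeta> into the fixed point equation for its reflection \<eta>, using
    \<open>u * cnj u = 1\<close> and \<open>cnj \<zeta> * \<eta> = 1\<close>.\<close>
  then have "u * \<eta>\<^sup>2 * (cnj u * cnj \<zeta> + cnj b) = u * \<eta>\<^sup>2 * (cnj \<zeta> * (1 + cnj u * b * cnj \<zeta>))"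
    by simp
  moreover have "u * \<eta>\<^sup>2 * (cnj u * cnj \<zeta> + cnj b) = \<eta> + u * cnj b * \<eta>\<^sup>2"
  proof -
    have "u * \<eta>\<^sup>2 * (cnj u * cnj \<zeta> + cnj b) = (u * cnj u) * (cnj \<zeta> * \<eta>) * \<eta> + u * cnj b * \<eta>\<^sup>2"
      by (simp add: power2_eq_square algebra_simps)
    then show ?thesis
      by (simp add: l \<eta>)
  qed
  moreover have "u * \<eta>\<^sup>2 * (cnj \<zeta> * (1 + cnj u * b * cnj \<zeta>)) = u * \<eta> + b"
  proof -
    have "u * \<eta>\<^sup>2 * (cnj \<zeta> * (1 + cnj u * b * cnj \<zeta>))
        = u * (cnj \<zeta> * \<eta>) * \<eta> + (u * cnj u) * (cnj \<zeta> * \<eta>) * (cnj \<zeta> * \<eta>) * b"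
      by (simp add: power2_eq_square algebra_simps)
    then show ?thesis
      by (simp add: l \<eta>)
  qed
  ultimately have "u * \<eta> + b = \<eta> * (1 + u * cnj b * \<eta>)"
    by (simp add: power2_eq_square algebra_simps)
  then have "cmod \<eta> \<ge> 1"
    using no_fix[of \<eta>] by linarith
  then have "cmod \<zeta> \<le> 1"
    using ge by (auto simp: \<eta>_def norm_divide le_divide_eq split: if_splits)
  then show thesis
    using that[of \<zeta>] fixed ge by simp
qed

section \<open>Passage to affine maps of the right half-plane\<close>

text \<open>The real part stays positive along every vertical line, which forces
  \<open>Im A = 0\<close>; points near the imaginary axis give \<open>Re B \<ge> 0\<close>.
  Surjectivity excludes \<open>Re B > 0\<close>, since the value \<open>Re B\<close> could only be
  attained on the axis.\<close>

lemma affine_right_half_plane: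
  assumes "\<And>w. Re w > 0 \<Longrightarrow> Re (A * w + B) > 0"
    and "\<And>w. Re w > 0 \<Longrightarrow> \<exists>w'. Re w' > 0 \<and> A * w' + B = w"
  shows "Im A = 0" "Re A > 0" "Re B = 0"
proof -
  have 1: "Re A * x - Im A * y + Re B > 0" if "x > 0" for x y
    using assms(1)[of "Complex x y"] that by simp
  show A: "Im A = 0"
  proof (rule ccontr)
    assume "Im A \<noteq> 0"
    then show False
      \<comment> \<open>This height makes the expression in \<open>1\<close> equal to 0 at
        \<open>x = 1\<close>.\<close>
      using 1[of 1 "(Re A + Re B) / Im A"] by simp
  qed
  have B: "Re B \<ge> 0"
  proof (rule ccontr)
    assume *: "\<not> Re B \<ge> 0"
    define x where "x = - Re B / (\<bar>Re A\<bar> + 1)"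
    have x: "x > 0"
      using * by (simp add: x_def divide_neg_pos)
    have "Re A * x \<le> \<bar>Re A\<bar> * x"
      using x by (intro mult_right_mono) auto
    also have "\<dots> < (\<bar>Re A\<bar> + 1) * x"
      using x by simp
    also have "\<dots> = - Re B"
      by (simp add: x_def)
    finally show False
      using 1[OF x, of 0] by simp
  qed
  obtain w where w: "Re w > 0" "A * w + B = 1"
    using assms(2)[of 1] by auto
  show "Re A > 0"
  proof (rule ccontr)
    assume *: "\<not> Re A > 0"
    show False
    proof (cases "Re A = 0")
      case True
      then have "A = 0"
        using A by (simp add: complex_eq_iff)
      then have "B = 1" "B = 2"
        using w assms(2)[of 2] by auto
      then show False by simp
    next
      case False
      then have neg: "Re A < 0"
        using * by simp
      then have "(1 + Re B) / - Re A > 0"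
        using B by (intro divide_pos_pos) auto
      then show False
        using 1[of "(1 + Re B) / - Re A" 0] neg by (simp add: field_simps)
    qed
  qed
  have "Re B \<le> 0"
  proof (rule ccontr)
    assume "\<not> Re B \<le> 0"
    then obtain w where "Re w > 0" "A * w + B = of_real (Re B)"
      using assms(2)[of "of_real (Re B)"] by auto
    then have "Re w > 0" "Re (A * w + B) = Re B"
      by simp_all
    then have "Re A * Re w = 0"
      using A by simp
    then show False
      using \<open>Re A > 0\<close> \<open>Re w > 0\<close> by simp
  qed
  then show "Re B = 0"
    using B by simp
qed

text \<open>The Cayley transform is normalized to send the boundary point \<zeta> to infinity, so
  that disc automorphisms fixing \<zeta> become affine.\<close>

lemma Cayley_transform:
  assumes "cmod \<zeta> = 1"
  shows "cmod z < 1 \<Longrightarrow> Re ((\<zeta> + z) / (\<zeta> - z)) > 0"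
    and "Re w > 0 \<Longrightarrow> cmod (\<zeta> * (w - 1) / (w + 1)) < 1"
    and "cmod z < 1 \<Longrightarrow> w = (\<zeta> + z) / (\<zeta> - z) \<Longrightarrow> \<zeta> * (w - 1) / (w + 1) = z"
    and "Re w > 0 \<Longrightarrow> z = \<zeta> * (w - 1) / (w + 1) \<Longrightarrow> (\<zeta> + z) / (\<zeta> - z) = w"
proof -
  have \<zeta>: "\<zeta> \<noteq> 0" "\<zeta> * cnj \<zeta> = 1"
    using assms by (auto simp: complex_norm_square[symmetric])
  show "Re ((\<zeta> + z) / (\<zeta> - z)) > 0" if "cmod z < 1"
  proof -
    have ne: "\<zeta> - z \<noteq> 0"
      using that assms by auto
    have "Re ((\<zeta> + z) * cnj (\<zeta> - z)) = (cmod \<zeta>)\<^sup>2 - (cmod z)\<^sup>2"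
      unfolding cmod_power2 by (simp add: algebra_simps power2_eq_square)
    also have "\<dots> > 0"
      using that assms by (simp add: power_less_one_iff)
    finally show ?thesis
      using ne by (simp only: complex_div_cnj[of "\<zeta> + z"] Re_divide_of_real of_real_power[symmetric]) simp
  qed
  show "cmod (\<zeta> * (w - 1) / (w + 1)) < 1" if "Re w > 0"
  proof -
    have "(cmod (w - 1))\<^sup>2 < (cmod (w + 1))\<^sup>2"
      unfolding cmod_power2 using that by (simp add: power2_eq_square algebra_simps)
    then have "cmod (w - 1) < cmod (w + 1)"
      using power_less_imp_less_base norm_ge_zero by blast
    then show ?thesis
      using assms by (simp add: norm_mult norm_divide divide_simps)
  qed
  show "\<zeta> * (w - 1) / (w + 1) = z" if "cmod z < 1" "w = (\<zeta> + z) / (\<zeta> - z)"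
  proof -
    have ne: "\<zeta> - z \<noteq> 0"
      using that assms by auto
    have "w - 1 = 2 * z / (\<zeta> - z)" "w + 1 = 2 * \<zeta> / (\<zeta> - z)"
      using ne by (simp_all add: that(2) field_simps)
    then show ?thesis
      using ne \<zeta> by simp
  qed
  show "(\<zeta> + z) / (\<zeta> - z) = w" if "Re w > 0" "z = \<zeta> * (w - 1) / (w + 1)"
  proof -
    have ne: "w + 1 \<noteq> 0"
      using that by (auto simp: complex_eq_iff)
    have "\<zeta> + z = 2 * \<zeta> * w / (w + 1)" "\<zeta> - z = 2 * \<zeta> / (w + 1)"
      using ne by (simp_all add: that(2) field_simps)
    then show ?thesis
      using ne \<zeta> by simp
  qed
qed

text \<open>In a coordinate where \<zeta> is infinity, a Moebius map fixing \<zeta> fixes infinity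
  and is affine. The coefficients come from writing \<open>(\<zeta> + t) / (\<zeta> - t)\<close> as
  \<open>2 * \<zeta> / (\<zeta> - t) - 1\<close>.\<close>

lemma Moebius_Cayley:
  assumes "cmod u = 1" "cmod b < 1" "cmod \<zeta> = 1" "u * \<zeta> + b = \<zeta> * (1 + u * cnj b * \<zeta>)"
  obtains A B where "\<And>z t. cmod z < 1 \<Longrightarrow> cmod t < 1 \<Longrightarrow> t * (1 + u * cnj b * z) = u * z + b \<Longrightarrow>
    (\<zeta> + t) / (\<zeta> - t) = A * ((\<zeta> + z) / (\<zeta> - z)) + B"
proof -
  define q where "q = u * (1 - cnj b * \<zeta>)"
  define A where "A = (1 + u * cnj b * \<zeta>) / q"
  define B where "B = A - 2 * \<zeta> * u * cnj b / q - 1"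
  have q: "q \<noteq> 0"
    using assms one_minus_cnj_mult_nz[of b \<zeta>] by (auto simp: q_def)
  show thesis
  proof (rule that)
    fix z t assume z: "cmod z < 1" "cmod t < 1" "t * (1 + u * cnj b * z) = u * z + b"
    have ne: "\<zeta> - z \<noteq> 0" "\<zeta> - t \<noteq> 0"
      using z assms by auto
    \<comment> \<open>The fixed point equation makes the right-hand side vanish at
      \<open>z = \<zeta>\<close>, so the factor \<open>\<zeta> - z\<close> splits off.\<close>
    have "(\<zeta> - t) * (1 + u * cnj b * z) = \<zeta> * (1 + u * cnj b * z) - (u * z + b)"
      using z(3) by (simp add: algebra_simps)
    also have "\<dots> = q * (\<zeta> - z)"
      using assms(4) by (simp add: q_def algebra_simps)
    finally have *: "(\<zeta> - t) * (1 + u * cnj b * z) = q * (\<zeta> - z)" .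
    then have "1 + u * cnj b * z \<noteq> 0"
      using ne q by auto
    then have 1: "1 / (\<zeta> - t) = (1 + u * cnj b * z) / (q * (\<zeta> - z))"
      unfolding *[symmetric] using ne by simp
    have "(\<zeta> + t) / (\<zeta> - t) = 2 * \<zeta> * (1 / (\<zeta> - t)) - 1"
      using ne by (simp add: field_simps)
    also have "\<dots> = 2 * \<zeta> * (1 + u * cnj b * z) / (q * (\<zeta> - z)) - 1"
      by (simp add: 1)
    also have "\<dots> = A * (2 * \<zeta> / (\<zeta> - z)) - 2 * \<zeta> * u * cnj b / q - 1"
      using ne q by (simp add: A_def field_simps)
    also have "2 * \<zeta> / (\<zeta> - z) = (\<zeta> + z) / (\<zeta> - z) + 1"
      using ne by (simp add: field_simps)
    finally show "(\<zeta> + t) / (\<zeta> - t) = A * ((\<zeta> + z) / (\<zeta> - z)) + B"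
      by (simp add: B_def algebra_simps)
  qed
qed

section \<open>Models on a strip or a half-plane\<close>

lemma open_Re_gt_0: "open {w. Re w > 0}"
  by (rule open_halfspace_Re_gt)

text \<open>A Riemann map conjugates the translation by \<open>P\<close> to a disc automorphism
  \<tau>. It has no fixed point because \<open>P \<noteq> 0\<close>; sending a boundary fixed point
  to infinity makes it affine.\<close>

lemma right_half_plane_model:
  assumes "open S" "simply_connected S" "S \<noteq> {}" "S \<noteq> UNIV" "P \<noteq> 0"
    and shift: "\<And>z. z \<in> S \<Longrightarrow> z + P \<in> S" "\<And>z. z \<in> S \<Longrightarrow> z - P \<in> S"
  obtains h A \<beta> where "h holomorphic_on {w. Re w > 0}" "inj_on h {w. Re w > 0}" "h ` {w. Re w > 0} = S"
    "A > 0" "\<And>w. Re w > 0 \<Longrightarrow> h (of_real A * w + \<i> * of_real \<beta>) = h w + P"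
proof -
  obtain f g where fg: "f holomorphic_on S" "g holomorphic_on ball 0 1"
    "\<And>z. z \<in> S \<Longrightarrow> f z \<in> ball 0 1 \<and> g (f z) = z" "\<And>z. z \<in> ball 0 1 \<Longrightarrow> g z \<in> S \<and> f (g z) = z"
    using Riemann_mapping_theorem[of S] assms(1-4) by metis
  define \<tau> where "\<tau> = (\<lambda>z. f (g z + P))"
  define \<sigma> where "\<sigma> = (\<lambda>z. f (g z - P))"
  have \<tau>: "\<tau> z \<in> ball 0 1" "g (\<tau> z) = g z + P" and \<sigma>: "\<sigma> z \<in> ball 0 1" "g (\<sigma> z) = g z - P"
    if "z \<in> ball 0 1" for z
    using fg(3)[OF shift(1)] fg(3)[OF shift(2)] fg(4)[OF that] by (auto simp: \<tau>_def \<sigma>_def)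
  have \<sigma>\<tau>: "\<sigma> (\<tau> z) = z" and \<tau>\<sigma>: "\<tau> (\<sigma> z) = z" if "z \<in> ball 0 1" for z
    using \<tau>[OF that] \<sigma>[OF that] fg(4)[OF that] by (simp_all add: \<sigma>_def \<tau>_def)
  have holo: "\<tau> holomorphic_on ball 0 1" "\<sigma> holomorphic_on ball 0 1"
    using fg(4) shift unfolding \<tau>_def \<sigma>_def
    by (auto intro!: holomorphic_on_compose_gen[OF _ fg(1), unfolded o_def] holomorphic_intros fg(2))
  obtain u b where u: "cmod u = 1" "cmod b < 1"
    "\<And>z. z \<in> ball 0 1 \<Longrightarrow> \<tau> z * (1 + u * cnj b * z) = u * z + b"
  proof (rule disc_automorphism[OF holo _ _ \<sigma>\<tau>])
    show "\<tau> ` ball 0 1 \<subseteq> ball 0 1" "\<sigma> ` ball 0 1 \<subseteq> ball 0 1"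
      using \<tau>(1) \<sigma>(1) by blast+
  qed (auto intro: that)
  have nofix: "u * z + b \<noteq> z * (1 + u * cnj b * z)" if "cmod z < 1" for z
  proof
    assume "u * z + b = z * (1 + u * cnj b * z)"
    then have "\<tau> z * (1 + u * cnj b * z) = z * (1 + u * cnj b * z)"
      using u(3)[of z] that by simp
    \<comment> \<open>This is the denominator \<open>1 + u * cnj b * z\<close>, written so that the
      nonvanishing lemma applies.\<close>
    moreover have "1 - cnj (- cnj u * b) * z \<noteq> 0"
      using u that by (intro one_minus_cnj_mult_nz) (auto simp: norm_mult)
    ultimately have "\<tau> z = z"
      by simp
    then show False
      using \<tau>(2)[of z] that \<open>P \<noteq> 0\<close> by simp
  qed
  obtain \<zeta> where \<zeta>: "cmod \<zeta> = 1" "u * \<zeta> + b = \<zeta> * (1 + u * cnj b * \<zeta>)"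
    using disc_automorphism_boundary_fixed_point[OF u(1,2) nofix] by blast
  define c where "c = (\<lambda>z. (\<zeta> + z) / (\<zeta> - z))"
  define d where "d = (\<lambda>w. \<zeta> * (w - 1) / (w + 1))"
  have c: "Re (c z) > 0" "d (c z) = z" if "cmod z < 1" for z
    using Cayley_transform(1,3)[OF \<zeta>(1)] that by (auto simp: c_def d_def)
  have d: "cmod (d w) < 1" "c (d w) = w" if "Re w > 0" for w
    using Cayley_transform(2,4)[OF \<zeta>(1)] that by (auto simp: c_def d_def)
  obtain A B where AB: "\<And>z. cmod z < 1 \<Longrightarrow> c (\<tau> z) = A * c z + B"
  proof (rule Moebius_Cayley[OF u(1,2) \<zeta>])
    fix A B
    assume *: "\<And>z t. cmod z < 1 \<Longrightarrow> cmod t < 1 \<Longrightarrow> t * (1 + u * cnj b * z) = u * z + b \<Longrightarrow>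
      (\<zeta> + t) / (\<zeta> - t) = A * ((\<zeta> + z) / (\<zeta> - z)) + B"
    show thesis
      by (rule that[of A B]) (use * \<tau>(1) u(3) in \<open>auto simp: c_def\<close>)
  qed
  have ABw: "A * w + B = c (\<tau> (d w))" if "Re w > 0" for w
    using AB[OF d(1)[OF that]] d(2)[OF that] by simp
  have "Re (A * w + B) > 0" if w: "Re w > 0" for w
    unfolding ABw[OF w] using c(1) \<tau>(1)[of "d w"] d(1)[OF w] by simp
  moreover have "\<exists>w'. Re w' > 0 \<and> A * w' + B = w" if w: "Re w > 0" for w
  proof (intro exI conjI)
    have s: "cmod (\<sigma> (d w)) < 1"
      using \<sigma>(1)[of "d w"] d(1)[OF w] by simp
    then show "Re (c (\<sigma> (d w))) > 0"
      by (rule c)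
    show "A * c (\<sigma> (d w)) + B = w"
      using ABw[OF c(1)[OF s]] c(2)[OF s] \<tau>\<sigma>[of "d w"] d[OF w] by simp
  qed
  ultimately have "Im A = 0" "Re A > 0" "Re B = 0"
    using affine_right_half_plane[of A B] by blast+
  then have AB': "A = of_real (Re A)" "B = \<i> * of_real (Im B)" "Re A > 0"
    by (auto simp: complex_eq_iff)
  have inj_d: "inj_on d {w. Re w > 0}"
    by (rule inj_on_inverseI[of _ c]) (simp add: d)
  have inj_g: "inj_on g (ball 0 1)"
    by (rule inj_on_inverseI[of _ f]) (simp add: fg)
  have im_d: "d ` {w. Re w > 0} = ball 0 1"
  proof (intro equalityI subsetI)
    fix z :: complex assume "z \<in> ball 0 1"
    then show "z \<in> d ` {w. Re w > 0}"
      using c[of z] by (intro image_eqI[where x = "c z"]) auto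
  qed (auto simp: d)
  have im_g: "g ` ball 0 1 = S"
  proof (intro equalityI subsetI)
    fix z assume "z \<in> S"
    then show "z \<in> g ` ball 0 1"
      using fg(3)[of z] by (intro image_eqI[where x = "f z"]) auto
  qed (use fg(4) in auto)
  have "w + 1 \<noteq> 0" if "Re w > 0" for w
    using that by (auto simp: complex_eq_iff)
  then have "d holomorphic_on {w. Re w > 0}"
    unfolding d_def by (intro holomorphic_intros) auto
  then have "g \<circ> d holomorphic_on {w. Re w > 0}"
    by (rule holomorphic_on_compose) (simp add: im_d fg)
  moreover have "inj_on (g \<circ> d) {w. Re w > 0}"
    by (intro comp_inj_on inj_d) (simp add: im_d inj_g)
  moreover have "(g \<circ> d) ` {w. Re w > 0} = S"
    by (simp only: image_comp[symmetric] im_d im_g)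
  moreover have "(g \<circ> d) (of_real (Re A) * w + \<i> * of_real (Im B)) = (g \<circ> d) w + P" if "Re w > 0" for w
  proof -
    have "cmod (\<tau> (d w)) < 1" "g (\<tau> (d w)) = g (d w) + P"
      using \<tau>[of "d w"] d(1)[OF that] by auto
    then show ?thesis
      using ABw[OF that] c(2) unfolding AB'(1,2)[symmetric] by simp
  qed
  ultimately show thesis
    using AB'(3) by (intro that[of "g \<circ> d" "Re A" "Im B"]) auto
qed

text \<open>An affine automorphism of the half-plane is a translation or, around its boundary fixed point,
  a dilation; the logarithm turns a dilation into a translation of a strip.\<close>

lemma strip_or_half_plane_model_aux:
  assumes h: "h holomorphic_on {w. Re w > 0}" "inj_on h {w. Re w > 0}" "h ` {w. Re w > 0} = S"
    and A: "A > 1 \<or> A = 1 \<and> \<beta> > 0"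
    and step: "\<And>w. Re w > 0 \<Longrightarrow> h (of_real A * w + \<i> * of_real \<beta>) = h w + P"
  obtains V g where "V = {z. Re z > 0} \<or> (\<exists>a>0. V = {z. \<bar>Re z\<bar> < a})"
    "g holomorphic_on V" "inj_on g V" "g ` V = S" "\<And>z. z \<in> V \<Longrightarrow> g (z + \<i>) = g z + P"
  using A
proof
  assume A: "A = 1 \<and> \<beta> > 0"
  \<comment> \<open>Rescaling by \<beta> turns the step \<open>\<i> * \<beta>\<close> of the
    parabolic translation into \<open>\<i>\<close>.\<close>
  define s where "s = (\<lambda>z. of_real \<beta> * z :: complex)"
  have s: "s ` {z. Re z > 0} = {w. Re w > 0}"
  proof (intro equalityI subsetI)
    fix w :: complex assume "w \<in> {w. Re w > 0}"
    then show "w \<in> s ` {z. Re z > 0}"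
      using A by (intro image_eqI[where x = "w / of_real \<beta>"]) (auto simp: s_def)
  qed (use A in \<open>auto simp: s_def\<close>)
  show thesis
  proof (rule that[of "{z. Re z > 0}" "h \<circ> s"])
    have "s holomorphic_on {z. Re z > 0}"
      unfolding s_def by (intro holomorphic_intros)
    then show "h \<circ> s holomorphic_on {z. Re z > 0}"
      by (rule holomorphic_on_compose) (simp add: s h)
    show "inj_on (h \<circ> s) {z. Re z > 0}"
      by (rule comp_inj_on) (use A h s in \<open>auto simp: s_def inj_on_def\<close>)
    show "(h \<circ> s) ` {z. Re z > 0} = S"
      by (simp only: image_comp[symmetric] s h(3))
    show "(h \<circ> s) (z + \<i>) = (h \<circ> s) z + P" if "z \<in> {z. Re z > 0}" for z
      using step[of "s z"] that A by (simp add: s_def algebra_simps)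
  qed simp
next
  assume A: "A > 1"
  define L where "L = ln A"
  have L: "L > 0"
    using A by (simp add: L_def)
  \<comment> \<open>The fixed point of the map \<open>A * w + \<i> * \<beta>\<close>, on the
    imaginary axis.\<close>
  define w0 where "w0 = \<i> * of_real (\<beta> / (1 - A))"
  have w0: "of_real A * w0 + \<i> * of_real \<beta> = w0"
    using A by (simp add: w0_def complex_eq_iff field_simps)
  \<comment> \<open>The argument of \<open>exp (- \<i> * L * z)\<close> is
    \<open>- L * Re z\<close>, so this half-width corresponds to the angle \<open>\<pi>/2\<close>.
    Adding \<open>\<i>\<close> to \<open>z\<close> multiplies the exponential by
    \<open>exp L = A\<close>.\<close>
  define a where "a = pi / (2 * L)"
  define s where "s = (\<lambda>z. w0 + exp (- \<i> * of_real L * z))"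
  define V where "V = {z. \<bar>Re z\<bar> < a}"
  have V: "\<bar>Im (- \<i> * of_real L * z)\<bar> < pi / 2" if "z \<in> V" for z
  proof -
    have "L * \<bar>Re z\<bar> < L * a"
      using that L by (simp add: V_def)
    also have "L * a = pi / 2"
      using L by (simp add: a_def)
    finally show ?thesis
      using L by (simp add: abs_mult)
  qed
  have inj: "inj_on s V"
  proof (rule inj_onI)
    fix x y assume xy: "x \<in> V" "y \<in> V" "s x = s y"
    have "Ln (exp (- \<i> * of_real L * z)) = - \<i> * of_real L * z" if "z \<in> V" for z
      using V[OF that] pi_gt_zero by (intro Ln_exp) linarith+
    then have "- \<i> * of_real L * x = - \<i> * of_real L * y"
      using xy by (metis add_left_cancel s_def)
    then show "x = y"
      using L by simp
  qed
  have s: "s ` V = {w. Re w > 0}"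
  proof (intro equalityI subsetI)
    fix w assume "w \<in> s ` V"
    then obtain z where z: "z \<in> V" "w = s z"
      by auto
    have "cos (Im (- \<i> * of_real L * z)) > 0"
      using V[OF z(1)] by (intro cos_gt_zero_pi) linarith+
    then show "w \<in> {w. Re w > 0}"
      using z(2) by (simp add: s_def w0_def Re_exp)
  next
    fix w assume "w \<in> {w. Re w > 0}"
    then have w: "Re (w - w0) > 0"
      by (simp add: w0_def)
    then have ne: "w - w0 \<noteq> 0"
      by (metis less_irrefl zero_complex.sel(1))
    define z where "z = \<i> * Ln (w - w0) / of_real L"
    have "\<bar>Im (Ln (w - w0))\<bar> < pi / 2"
      using w Re_Ln_pos_lt[OF ne] by blast
    then have "z \<in> V"
      using L by (simp add: z_def V_def a_def abs_mult field_simps Re_divide_of_real)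
    moreover have "- \<i> * of_real L * z = Ln (w - w0)"
      using L by (simp add: z_def)
    then have "w = s z"
      using ne by (simp only: s_def exp_Ln) simp
    ultimately show "w \<in> s ` V"
      by blast
  qed
  show thesis
  proof (rule that[of V "h \<circ> s"])
    have "a > 0"
      using L by (simp add: a_def)
    then show "V = {z. Re z > 0} \<or> (\<exists>a>0. V = {z. \<bar>Re z\<bar> < a})"
      unfolding V_def by blast
    have "s holomorphic_on V"
      unfolding s_def by (intro holomorphic_intros)
    then show "h \<circ> s holomorphic_on V"
      by (rule holomorphic_on_compose) (simp add: s h)
    show "inj_on (h \<circ> s) V"
      by (rule comp_inj_on[OF inj]) (simp add: s h)
    show "(h \<circ> s) ` V = S"
      by (simp only: image_comp[symmetric] s h(3))
    show "(h \<circ> s) (z + \<i>) = (h \<circ> s) z + P" if "z \<in> V" for z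
    proof -
      have "exp (of_real L :: complex) = of_real A"
        using A by (simp add: L_def exp_of_real)
      then have e: "exp (- \<i> * of_real L * (z + \<i>)) = of_real A * exp (- \<i> * of_real L * z)"
        by (simp add: algebra_simps exp_add[symmetric] exp_diff exp_minus field_simps)
      have "s (z + \<i>) = of_real A * s z + \<i> * of_real \<beta>"
        unfolding s_def e using w0 by (simp add: algebra_simps)
      moreover have "Re (s z) > 0"
        using s that by blast
      ultimately show ?thesis
        using step[of "s z"] by simp
    qed
  qed
qed

text \<open>If the affine map contracts or translates downwards, its inverse has the required form
  and realizes the shift by \<open>- P\<close>. The identity is excluded by
  \<open>P \<noteq> 0\<close>.\<close>

lemma strip_or_half_plane_model:
  assumes "open S" "simply_connected S" "S \<noteq> {}" "S \<noteq> UNIV" "P \<noteq> 0"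
    and shift: "\<And>z. z \<in> S \<Longrightarrow> z + P \<in> S" "\<And>z. z \<in> S \<Longrightarrow> z - P \<in> S"
  obtains V g Q where "V = {z. Re z > 0} \<or> (\<exists>a>0. V = {z. \<bar>Re z\<bar> < a})" "Q = P \<or> Q = - P"
    "g holomorphic_on V" "inj_on g V" "g ` V = S" "\<And>z. z \<in> V \<Longrightarrow> g (z + \<i>) = g z + Q"
proof -
  obtain h A \<beta> where h: "h holomorphic_on {w. Re w > 0}" "inj_on h {w. Re w > 0}" "h ` {w. Re w > 0} = S"
    "A > 0" "\<And>w. Re w > 0 \<Longrightarrow> h (of_real A * w + \<i> * of_real \<beta>) = h w + P"
    using right_half_plane_model[OF assms] by metis
  have inv: "h (of_real (1 / A) * w + \<i> * of_real (- \<beta> / A)) = h w - P" if "Re w > 0" for w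
  proof -
    define v where "v = of_real (1 / A) * w + \<i> * of_real (- \<beta> / A)"
    have "Re v > 0" "of_real A * v + \<i> * of_real \<beta> = w"
      using that \<open>A > 0\<close> by (auto simp: v_def complex_eq_iff right_diff_distrib)
    then show ?thesis
      using h(5)[of v] by (simp add: v_def)
  qed
  have "A \<noteq> 1 \<or> \<beta> \<noteq> 0"
    using h(5)[of 1] \<open>P \<noteq> 0\<close> by auto
  have "(A > 1 \<or> A = 1 \<and> \<beta> > 0) \<or> (1 / A > 1 \<or> 1 / A = 1 \<and> - \<beta> / A > 0)"
  proof (cases "A = 1")
    case True
    then show ?thesis
      using \<open>A \<noteq> 1 \<or> \<beta> \<noteq> 0\<close> by auto
  next
    case False
    then show ?thesis
      using \<open>A > 0\<close> by (auto simp: field_simps)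
  qed
  then consider "A > 1 \<or> A = 1 \<and> \<beta> > 0" | "1 / A > 1 \<or> 1 / A = 1 \<and> - \<beta> / A > 0"
    by blast
  then show thesis
  proof cases
    case 1
    show thesis
      by (rule strip_or_half_plane_model_aux[OF h(1-3) 1 h(5)], assumption, rule that[where Q = P]) auto
  next
    case 2
    have step: "h (of_real (1 / A) * w + \<i> * of_real (- \<beta> / A)) = h w + - P" if "Re w > 0" for w
      using inv[OF that] by simp
    show thesis
      by (rule strip_or_half_plane_model_aux[OF h(1-3) 2 step], assumption, rule that[where Q = "- P"]) auto
  qed
qed

lemma int_shift:
  fixes g :: "complex \<Rightarrow> complex"
  assumes "\<And>z. z \<in> V \<Longrightarrow> g (z + \<i>) = g z + Q" and "\<And>z (m::int). z \<in> V \<Longrightarrow> z + \<i> * of_int m \<in> V" and "z \<in> V"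
  shows "g (z + \<i> * of_int m) = g z + of_int m * Q"
proof (induction m rule: int_induct[where k = 0])
  case base
  show ?case by simp
next
  case (step1 m)
  have "g (z + \<i> * of_int m + \<i>) = g (z + \<i> * of_int m) + Q"
    by (intro assms)
  then show ?case
    using step1 by (simp add: algebra_simps)
next
  case (step2 m)
  have "g (z + \<i> * of_int (m - 1) + \<i>) = g (z + \<i> * of_int (m - 1)) + Q"
    by (intro assms)
  then show ?case
    using step2 by (simp add: algebra_simps)
qed

section \<open>The parabolic case and the puncture\<close>

text \<open>The map \<open>exp (- 2\<pi>z)\<close> identifies the half-plane modulo
  \<open>\<i>\<close> with the punctured disc, to which \<open>G\<close> descends as an injective
  bounded function \<psi>. Its extension \<open>F\<close> over 0 is open, and \<open>F 0\<close> is
  the new point.\<close>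

lemma periodic_half_plane_covering:
  assumes holo: "G holomorphic_on {z. Re z > 0}" and "bounded (G ` {z. Re z > 0})"
    and periodic: "\<And>z w. Re z > 0 \<Longrightarrow> Re w > 0 \<Longrightarrow> G z = G w \<longleftrightarrow> (\<exists>m::int. w = z + \<i> * of_int m)"
  obtains p where "p \<notin> G ` {z. Re z > 0}" "open (insert p (G ` {z. Re z > 0}))"
proof -
  define \<Omega> where "\<Omega> = G ` {z. Re z > 0}"
  \<comment> \<open>Other logarithms of \<open>w\<close> change the argument of \<open>G\<close> by
    an integer multiple of \<open>\<i>\<close>, so \<psi> is holomorphic even across the cut of
    \<open>Ln\<close>.\<close>
  define \<psi> where "\<psi> = (\<lambda>w. G (- Ln w / (2 * of_real pi)))"
  define D where "D = ball (0::complex) 1 - {0}"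
  have Re_pos: "Re (- l / (2 * of_real pi)) > 0" if "exp l \<in> D" for l
  proof -
    have "exp (Re l) < 1"
      using that by (simp add: D_def)
    moreover have "- l / (2 * of_real pi) = (- l) / of_real (2 * pi)"
      by simp
    ultimately show ?thesis
      by (simp only: Re_divide_of_real) (simp add: field_simps)
  qed
  have \<psi>: "G (- l / (2 * of_real pi)) = \<psi> (exp l)" if "exp l \<in> D" for l
  proof -
    obtain m :: int where "l = Ln (exp l) + (of_int (2 * m) * of_real pi) * \<i>"
      using exp_eq[of l "Ln (exp l)"] by auto
    then have "- Ln (exp l) / (2 * of_real pi) = - l / (2 * of_real pi) + \<i> * of_int m"
      by (simp add: field_simps)
    then show ?thesis
      unfolding \<psi>_def using periodic[OF Re_pos[of l] Re_pos[of "Ln (exp l)"]] that by auto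
  qed
  have D_exp: "\<exists>l. w = exp l" if "w \<in> D" for w
    using that exp_Ln[of w] by (metis D_def Diff_iff singletonI)
  have inj: "inj_on \<psi> D"
  proof (rule inj_onI)
    fix x y assume xy: "x \<in> D" "y \<in> D" "\<psi> x = \<psi> y"
    obtain k l where kl: "x = exp k" "y = exp l"
      using D_exp xy by metis
    then obtain m :: int where m: "- l / (2 * of_real pi) = - k / (2 * of_real pi) + \<i> * of_int m"
      using xy \<psi>[of k] \<psi>[of l] periodic[OF Re_pos[of k] Re_pos[of l]] by auto
    then have "k = l + (of_int (2 * m) * of_real pi) * \<i>"
      by (simp add: field_simps)
    then show "x = y"
      unfolding kl exp_eq by (intro exI[of _ m]) simp
  qed
  have im: "\<psi> ` D = \<Omega>"
  proof (intro equalityI subsetI)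
    fix x assume "x \<in> \<psi> ` D"
    then obtain l where "exp l \<in> D" "x = \<psi> (exp l)"
      using D_exp by blast
    then show "x \<in> \<Omega>"
      unfolding \<Omega>_def using \<psi>[of l] Re_pos[of l]
      by (intro image_eqI[where x = "- l / (2 * of_real pi)"]) auto
  next
    fix x assume "x \<in> \<Omega>"
    then obtain z where z: "Re z > 0" "x = G z"
      by (auto simp: \<Omega>_def)
    then have "exp (- (2 * of_real pi * z)) \<in> D"
      by (simp add: D_def)
    then show "x \<in> \<psi> ` D"
      using \<psi>[of "- (2 * of_real pi * z)"] z by (intro image_eqI[where x = "exp (- (2 * of_real pi * z))"]) auto
  qed
  have "\<psi> field_differentiable (at w)" if w: "w \<in> D" for w
  proof -
    \<comment> \<open>On the cut a different branch is used: \<open>Ln (- v) + \<i> * pi\<close> is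
      a logarithm of \<open>v\<close> that is holomorphic near the negative axis.\<close>
    define e :: complex where "e = (if w \<in> \<real>\<^sub>\<le>\<^sub>0 then -1 else 1)"
    define c :: complex where "c = (if w \<in> \<real>\<^sub>\<le>\<^sub>0 then \<i> * of_real pi else 0)"
    have e: "e * w \<notin> \<real>\<^sub>\<le>\<^sub>0" "e \<noteq> 0"
      using w by (auto simp: e_def D_def complex_nonpos_Reals_iff complex_eq_iff)
    have ec: "exp (Ln (e * v) + c) = v" if "v \<noteq> 0" for v
      using that e by (auto simp: e_def c_def exp_add)
    have G: "G (- (Ln (e * v) + c) / (2 * of_real pi)) = \<psi> v" if "v \<in> D" for v
    proof -
      have "exp (Ln (e * v) + c) = v"
        using ec that by (simp add: D_def)
      then show ?thesis
        using \<psi>[of "Ln (e * v) + c"] that by metis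
    qed
    have "(\<lambda>v. - (Ln (e * v) + c) / (2 * of_real pi)) field_differentiable (at w)"
      using e by (intro derivative_intros field_differentiable_within_Ln
          field_differentiable_compose[where f = "\<lambda>v. e * v" and g = Ln, unfolded o_def]) auto
    moreover have "exp (Ln (e * w) + c) \<in> D"
      using ec[of w] w by (simp add: D_def)
    then have "G field_differentiable (at (- (Ln (e * w) + c) / (2 * of_real pi)))"
      by (intro holomorphic_on_imp_differentiable_at[OF holo open_Re_gt_0] CollectI Re_pos)
    ultimately have "(\<lambda>v. G (- (Ln (e * v) + c) / (2 * of_real pi))) field_differentiable (at w)"
      using field_differentiable_compose[unfolded o_def] by blast
    then obtain f' where f': "((\<lambda>v. G (- (Ln (e * v) + c) / (2 * of_real pi))) has_field_derivative f') (at w)"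
      unfolding field_differentiable_def by blast
    have "open D"
      by (simp add: D_def open_delete)
    then have "(\<psi> has_field_derivative f') (at w)"
      by (rule has_field_derivative_transform_within_open[OF f' _ w G])
    then show ?thesis
      unfolding field_differentiable_def by blast
  qed
  then have holo\<psi>: "\<psi> holomorphic_on ball 0 1 - {0}"
    by (auto simp: holomorphic_on_def D_def intro: field_differentiable_at_within)
  obtain B where "\<And>x. x \<in> \<Omega> \<Longrightarrow> norm x \<le> B"
    using assms(2) by (auto simp: \<Omega>_def bounded_iff)
  then have "eventually (\<lambda>z. norm (\<psi> z) \<le> B) (at 0)"
    unfolding eventually_at using im by (intro exI[of _ 1]) (auto simp: D_def)
  then obtain F where F: "F holomorphic_on ball 0 1" "\<And>z. z \<in> ball 0 1 - {0} \<Longrightarrow> F z = \<psi> z"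
    using holomorphic_on_extend_bounded[OF holo\<psi>] by auto
  have im': "F ` ball 0 1 = insert (F 0) \<Omega>"
  proof -
    have "ball 0 1 = insert (0::complex) D"
      by (auto simp: D_def)
    moreover have "F ` D = \<psi> ` D"
      using F(2) by (auto simp: D_def)
    ultimately show ?thesis
      by (simp add: im)
  qed
  have "\<not> F constant_on ball 0 1"
  proof
    assume "F constant_on ball 0 1"
    then have "F (1/2) = F (1/3)"
      unfolding constant_on_def by (metis mem_ball_0 norm_divide norm_numeral norm_one one_less_numeral_iff divide_less_eq_1_pos semiring_norm(76,77) zero_less_numeral)
    then show False
      using F(2)[of "1/2"] F(2)[of "1/3"] inj_onD[OF inj, of "1/2" "1/3"] by (simp add: D_def)
  qed
  then have openF: "open (F ` U)" if "open U" "U \<subseteq> ball 0 1" for U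
    using open_mapping_thm[OF F(1) open_ball connected_ball that] by simp
  have "F 0 \<notin> \<Omega>"
  proof
    assume "F 0 \<in> \<Omega>"
    then obtain w where "w \<in> D" "F 0 = \<psi> w"
      using im by blast
    then have w: "w \<in> D" "F 0 = F w"
      using F(2)[of w] by (simp_all add: D_def)
    \<comment> \<open>This radius keeps the ball around \<open>w\<close> inside the punctured disc
      and away from the ball of radius \<open>norm w / 2\<close> around 0.\<close>
    define r where "r = min (norm w / 2) (1 - norm w)"
    have r: "r > 0"
      using w by (auto simp: r_def D_def)
    define U where "U = ball w r"
    have U: "U \<subseteq> D"
    proof
      fix v assume "v \<in> U"
      then have "norm (v - w) < r"
        by (simp add: U_def dist_norm norm_minus_commute)
      then show "v \<in> D"
        using norm_triangle_ineq2[of v w] norm_triangle_ineq2[of w v] r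
        by (auto simp: D_def r_def norm_minus_commute)
    qed
    \<comment> \<open>Points near 0 whose values under \<open>F\<close> are also taken on
      \<open>U\<close>. As \<open>T\<close> is open, it contains a nonzero point, which contradicts
      injectivity of \<psi>.\<close>
    define T where "T = ball 0 (norm w / 2) \<inter> (ball 0 1 \<inter> F -` (F ` U))"
    have "open (F ` U)"
      using U by (intro openF) (auto simp: U_def D_def)
    then have "open T"
      unfolding T_def
      by (intro open_Int open_ball continuous_open_preimage holomorphic_on_imp_continuous_on F)
    moreover have "0 \<in> T"
      using w r by (auto simp: T_def U_def D_def intro!: image_eqI[of _ _ w])
    ultimately have "T \<noteq> {0}"
      using not_open_singleton by metis
    then obtain v where v: "v \<in> T" "v \<noteq> 0"
      using \<open>0 \<in> T\<close> by auto
    then obtain x where x: "x \<in> U" "F v = F x"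
      by (auto simp: T_def)
    then have "v = x"
      using v U F(2) inj by (auto simp: T_def D_def inj_on_def subset_iff)
    moreover have "norm x > norm w / 2"
      using x(1) norm_triangle_ineq2[of w x] by (auto simp: U_def r_def dist_norm)
    ultimately show False
      using v by (simp add: T_def)
  qed
  then show thesis
    using openF[of "ball 0 1"] im' that[of "F 0"] by (simp add: \<Omega>_def)
qed

text \<open>In any connected part of \<open>C\<close> containing \<open>p\<close>, the set
  \<open>{p}\<close> is both relatively open and closed.\<close>

lemma isolated_point_component:
  assumes "p \<in> C" "open U" "C \<inter> U = {p}"
  shows "{p} \<in> components (C :: 'a::t1_space set)"
  unfolding in_components_maximal
proof (intro conjI allI impI)
  fix T assume T: "T \<noteq> {} \<and> {p} \<subseteq> T \<and> T \<subseteq> C \<and> connected T"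
  have "T \<inter> U = {p}"
    using T assms by auto
  then have "openin (top_of_set T) {p}"
    using \<open>open U\<close> by (metis openin_open_Int)
  moreover have "closedin (top_of_set T) {p}"
    using T by (simp add: closedin_closed_Int[of "{p}" T, simplified] Int_absorb1 closedin_closed_subset)
  ultimately show "T = {p}"
    using T connected_clopen[of T] by (metis insert_not_empty)
qed (use assms in auto)

section \<open>Reduction of the domain to one of the two models\<close>

theorem lemma1p1:
  fixes \<Omega> :: "complex set"
  assumes "bounded_doubly_connected_domain \<Omega>"
    and "smooth_boundary \<Omega>"
    and "\<And>K. K \<in> components (- \<Omega>) \<Longrightarrow> bounded K \<Longrightarrow> \<not> (\<exists>p. K = {p})"
  shows "\<exists>\<gamma>. smooth_simple_closed_curve \<gamma> \<and> path_image \<gamma> \<subseteq> \<Omega> \<and>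
    (\<exists>H \<Omega>m \<Omega>p n.
       is_harmonic_measure \<Omega> (path_image \<gamma>) H \<and>
       components (\<Omega> - path_image \<gamma>) = {\<Omega>m, \<Omega>p} \<and> \<Omega>m \<noteq> \<Omega>p \<and>
       is_unit_normal \<gamma> \<Omega>m \<Omega>p n \<and>
       (\<forall>x\<in>path_image \<gamma>. \<exists>dp dm.
          has_derivative_from_within H x (n x) \<Omega>p dp \<and>
          has_derivative_from_within H x (n x) \<Omega>m dm \<and>
          dp + dm = 0))"
proof -
  have \<Omega>: "open \<Omega>" "connected \<Omega>" "bounded \<Omega>" "card (components (- \<Omega>)) = 2"
    using assms(1) by (auto simp: bounded_doubly_connected_domain_def)
  obtain J1 J2 where J12: "components (- \<Omega>) = {J1, J2}" "J1 \<noteq> J2"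
    using \<Omega>(4) by (auto simp: card_2_iff)
  \<comment> \<open>The complement of a bounded planar set has exactly one unbounded component, so
    one of the two is bounded and the other is not.\<close>
  have "\<exists>K L. components (- \<Omega>) = {K, L} \<and> bounded K \<and> \<not> bounded L"
    using cobounded_unbounded_components[of "- \<Omega>"] cobounded_unique_unbounded_components[of "- \<Omega>" J1 J2] J12 \<Omega>(3)
    by auto
  then obtain K L where KL: "components (- \<Omega>) = {K, L}" "bounded K" "\<not> bounded L"
    by auto
  obtain p where p: "p \<in> K"
    using in_components_nonempty[of K "- \<Omega>"] KL by auto
  then have p\<Omega>: "p \<notin> \<Omega>"
    using in_components_subset[of K "- \<Omega>"] KL by auto
  have J: "\<not> bounded J" if "J \<in> components (- \<Omega>)" "p \<notin> J" for J
    using that KL p by auto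
  have nsc: "\<not> simply_connected \<Omega>"
    using simply_connected_eq_unbounded_complement_components[OF \<Omega>(1)] KL by auto
  then obtain x where x: "x \<in> \<Omega>"
    by (metis equals0I simply_connected_empty)
  define X where "X = {z. p + exp z \<in> \<Omega>}"
  have "x - p \<noteq> 0"
    using x p\<Omega> by auto
  then have "Ln (x - p) \<in> X"
    using x by (simp add: X_def exp_Ln)
  then obtain S where "S \<in> components X"
    by (metis components_iff)
  then have S: "S \<in> components {z. p + exp z \<in> \<Omega>}"
    by (simp add: X_def)
  have S': "open S" "simply_connected S" "(\<lambda>z. p + exp z) ` S = \<Omega>" "S \<noteq> {}"
    using simply_connected_component_exp_preimage[OF \<Omega>(1) p\<Omega> J S]
      image_component_exp_preimage[OF \<Omega>(1,2) p\<Omega> S] in_components_nonempty[OF S] by auto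
  have "S \<noteq> UNIV"
  proof
    assume "S = UNIV"
    obtain B where B: "B > 0" "\<And>x. x \<in> \<Omega> \<Longrightarrow> norm x \<le> B"
      using \<Omega>(3) by (auto simp: bounded_pos)
    \<comment> \<open>If \<open>S\<close> were the plane, \<open>p + r\<close> would lie in \<Omega>
      for every \<open>r > 0\<close>; this \<open>r\<close> makes its norm exceed the bound
      \<open>B\<close>.\<close>
    define r where "r = B + norm p + 1"
    have "p + exp (of_real (ln r)) \<in> \<Omega>"
      using S'(3) \<open>S = UNIV\<close> by blast
    moreover have "r > 0"
      using B(1) norm_ge_zero[of p] by (simp add: r_def add_pos_nonneg)
    ultimately have "norm (p + of_real r) \<le> B"
      using B(2) by (simp add: exp_of_real)
    moreover have "r - norm p \<le> norm (p + of_real r)"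
      using norm_triangle_ineq2[of "of_real r" "- p"] \<open>r > 0\<close> by (simp add: add.commute)
    ultimately show False
      by (simp add: r_def)
  qed
  obtain P where P: "P \<noteq> 0" "\<And>z. z \<in> S \<Longrightarrow> z + P \<in> S" "\<And>z. z \<in> S \<Longrightarrow> z - P \<in> S"
    "\<And>z w. z \<in> S \<Longrightarrow> w \<in> S \<Longrightarrow> exp z = exp w \<longleftrightarrow> (\<exists>j::int. w = z + of_int j * P)"
    by (rule component_exp_preimage_stabilizer[OF \<Omega>(1,2) p\<Omega> nsc J S], assumption, assumption, rule that)
  obtain V g Q where V: "V = {z. Re z > 0} \<or> (\<exists>a>0. V = {z. \<bar>Re z\<bar> < a})" and Q: "Q = P \<or> Q = - P"
    and g: "g holomorphic_on V" "inj_on g V" "g ` V = S" "\<And>z. z \<in> V \<Longrightarrow> g (z + \<i>) = g z + Q"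
    by (rule strip_or_half_plane_model[OF S'(1,2,4) \<open>S \<noteq> UNIV\<close> P(1-3)], assumption, assumption, rule that)
  have shift: "z + \<i> * of_int m \<in> V" if "z \<in> V" for z and m :: int
    using that V by auto
  define G where "G = (\<lambda>z. p + exp (g z))"
  have G: "G holomorphic_on V"
    unfolding G_def by (intro holomorphic_intros g)
  have imG: "G ` V = \<Omega>"
    unfolding G_def S'(3)[symmetric] g(3)[symmetric] by (simp add: image_image)
  have periodic: "G z = G w \<longleftrightarrow> (\<exists>m::int. w = z + \<i> * of_int m)" if zw: "z \<in> V" "w \<in> V" for z w
  proof -
    have "G z = G w \<longleftrightarrow> (\<exists>j::int. g w = g z + of_int j * P)"
      using P(4)[of "g z" "g w"] zw g(3) by (auto simp: G_def)
    \<comment> \<open>Replacing \<open>P\<close> by \<open>- P\<close> only changes the sign of the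
      integer.\<close>
    also have "\<dots> \<longleftrightarrow> (\<exists>j::int. g w = g z + of_int j * Q)"
      using Q by (metis minus_minus mult_minus_left mult_minus_right of_int_minus)
    also have "\<dots> \<longleftrightarrow> (\<exists>j::int. g w = g (z + \<i> * of_int j))"
      using int_shift[where g = g and V = V and Q = Q and z = z, OF g(4) shift zw(1)] by simp
    also have "\<dots> \<longleftrightarrow> (\<exists>m::int. w = z + \<i> * of_int m)"
      using inj_on_eq_iff[OF g(2) zw(2) shift[OF zw(1)]] by simp
    finally show ?thesis .
  qed
  from V show ?thesis
  proof
    assume V: "V = {z. Re z > 0}"
    \<comment> \<open>Filling a puncture gives an open set, so \<open>q\<close> is isolated in the
      complement and \<open>{q}\<close> is a bounded component, contrary to the assumption.\<close>
    obtain q where q: "q \<notin> \<Omega>" "open (insert q \<Omega>)"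
      using periodic_half_plane_covering[of G] G \<Omega>(3) periodic imG unfolding V by auto
    have "{q} \<in> components (- \<Omega>)"
      by (rule isolated_point_component[OF _ q(2)]) (use q in auto)
    then show ?thesis
      using assms(3)[of "{q}"] by auto
  next
    assume "\<exists>a>0. V = {z. \<bar>Re z\<bar> < a}"
    then obtain a where a: "a > 0" "V = {z. \<bar>Re z\<bar> < a}"
      by auto
    interpret strip_covering \<Omega> a G
      by unfold_locales (use a G imG periodic in auto)
    show ?thesis
      using smooth_simple_closed_curve path_image_\<gamma> is_harmonic_measure components \<Omega>m_neq_\<Omega>p
        is_unit_normal normal_derivatives by (intro exI[of _ \<gamma>] conjI exI[of _ H] exI[of _ \<Omega>m] exI[of _ \<Omega>p] exI[of _ n]) auto
  qed
qed

end
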